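(* Let $r\geq 1$ and $d\geq 1$ be integers. Then $\mathcal{E}_d^{(r)}=(\Omega_1^{(r,d)},\Omega_2^{(r,d)},\dots,\Omega_d^{(r,d)})$ is an acyclic $d$-partition of the $r$-uniform complete hypergraph $K_{rd}^{(r)}$.
   Context: A hypergraph $\mathcal{H}=(V,E)$ is $r$-uniform if every hyperedge has $r$ elements; $K_n^{(r)}$ is the hypergraph on $V=\{1,\dots,n\}$ whose hyperedges are all $r$-element subsets. A hyperedge is written $(v_1,\dots,v_r)$ with $v_1<\dots<v_r$. For $1\leq a\leq d$ let $S_a=\{ra-(r-1),ra-(r-2),\dots,ra\}$. Define $\Omega_a^{(r,d)}$ as the $r$-uniform hypergraph with vertex set $\{1,\dots,rd\}$ whose hyperedges are the $(i_1,\dots,i_r)$ with $1\leq i_1<\dots<i_r\leq rd$ such that for some $1\leq t\leq r$ one has $i_1+\dots+i_r\equiv t-1 \pmod r$ and $i_t\in S_a$. A $d$-partition of $K_{rd}^{(r)}$ is an ordered tuple $(\mathcal{H}_1,\dots,\mathcal{H}_d)$ of sub-hypergraphs, each with vertex set $\{1,\dots,rd\}$, whose hyperedge sets are pairwise disjoint with union all hyperedges of $K_{rd}^{(r)}$. For an $r$-uniform $\mathcal{H}$ and $0\le s\le r$, $E_s(\mathcal{H})$ is the set of $s$-element subsets of $V$ contained in some hyperedge of $\mathcal{H}$ (so $E_0=\{\emptyset\}$ if $E(\mathcal{H})\neq\emptyset$, and $E_r(\mathcal{H})=E(\mathcal{H})$). The partition is homogeneous if for all $i$, $|E_s(\mathcal{H}_i)|=\binom{rd}{s}$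 for $0\leq s\leq r-1$ and $|E(\mathcal{H}_i)|=\binom{rd-1}{r-1}$. Betti numbers: let $C_{k-1}(\mathcal{H})$ ($1\le k\le r$) be the $\mathbb{Q}$-vector space with basis $[a_1,\dots,a_k]$ for $(a_1<\dots<a_k)\in E_k(\mathcal{H})$, $C_{-1}(\mathcal{H})=\mathbb{Q}[\emptyset]$, with boundary $\partial_{k-1}[a_1,\dots,a_k]=\sum_{j=1}^k(-1)^{j-1}[a_1,\dots,\widehat{a_j},\dots,a_k]$ (and $\partial_0[a]=[\emptyset]$, $\partial_r=0$, $C_{k}=0$ for $k\ge r$); then $b_{k-1}(\mathcal{H})=\dim_{\mathbb{Q}}\ker\partial_{k-1}/\operatorname{im}\partial_k$ for $0\leq k\leq r$ (the reduced Betti numbers of the associated simplicial complex). A homogeneous $d$-partition is acyclic if $b_{k-1}(\mathcal{H}_i)=0$ for all $1\le i\le d$ and $0\le k\le r$. *)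

theory Defs
  imports "Jordan_Normal_Form.VS_Connect" "HOL-Algebra.AbelCoset" "HOL-Number_Theory.Cong"
begin

record hypergraph =
  verts :: "nat set"
  edges :: "nat set set"

definition subhypergraph :: "hypergraph \<Rightarrow> hypergraph \<Rightarrow> bool" where
  "subhypergraph H G \<longleftrightarrow> verts H \<subseteq> verts G \<and> edges H \<subseteq> edges G"

definition complete_hypergraph :: "nat \<Rightarrow> nat \<Rightarrow> hypergraph" where
  "complete_hypergraph r n =
     \<lparr>verts = {1..n}, edges = {e. e \<subseteq> {1..n} \<and> card e = r}\<rparr>"

(* The hyperedge (v_1,...,v_r) with v_1 < ... < v_r is encoded as the set {v_1,...,v_r};
   vertex_at e t recovers v_t, with t starting at 1. *)
definition vertex_at :: "nat set \<Rightarrow> nat \<Rightarrow> nat" where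
  "vertex_at e t = sorted_list_of_set e ! (t - 1)"

definition S_block :: "nat \<Rightarrow> nat \<Rightarrow> nat set" where
  "S_block r a = {r * a - (r - 1)..r * a}"

definition Omega :: "nat \<Rightarrow> nat \<Rightarrow> nat \<Rightarrow> hypergraph" where
  "Omega r d a =
     \<lparr>verts = {1..r * d},
      edges = {e. e \<subseteq> {1..r * d} \<and> card e = r \<and>
                  (\<exists>t\<in>{1..r}. [(\<Sum>i\<in>e. i) = t - 1] (mod r) \<and> vertex_at e t \<in> S_block r a)}\<rparr>"

(* Ordered tuples (H_1,...,H_d) are lists of length d, so H_i is Hs ! (i - 1). *)
definition d_partition :: "nat \<Rightarrow> nat \<Rightarrow> hypergraph list \<Rightarrow> bool" where
  "d_partition r d Hs \<longleftrightarrow>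
     length Hs = d \<and>
     (\<forall>i<d. subhypergraph (Hs ! i) (complete_hypergraph r (r * d)) \<and> verts (Hs ! i) = {1..r * d}) \<and>
     (\<forall>i<d. \<forall>j<d. i \<noteq> j \<longrightarrow> edges (Hs ! i) \<inter> edges (Hs ! j) = {}) \<and>
     (\<Union>i<d. edges (Hs ! i)) = edges (complete_hypergraph r (r * d))"

definition E_sub :: "hypergraph \<Rightarrow> nat \<Rightarrow> nat set set" where
  "E_sub H s = {A. A \<subseteq> verts H \<and> finite A \<and> card A = s \<and> (\<exists>e\<in>edges H. A \<subseteq> e)}"

definition homogeneous_partition :: "nat \<Rightarrow> nat \<Rightarrow> hypergraph list \<Rightarrow> bool" where
  "homogeneous_partition r d Hs \<longleftrightarrow>
     d_partition r d Hs \<and>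
     (\<forall>i<d. (\<forall>s<r. card (E_sub (Hs ! i) s) = (r * d) choose s) \<and>
            card (edges (Hs ! i)) = (r * d - 1) choose (r - 1))"

(* The basis of C_p for an integer p: in degree -1 it is always the empty set alone,
   in degrees p >= r it is empty whenever H is r-uniform. *)
definition simplices :: "hypergraph \<Rightarrow> int \<Rightarrow> nat set set" where
  "simplices H p = (if p < -1 then {} else if p = -1 then {{}} else E_sub H (nat (p + 1)))"

(* A chain is given by its coordinates, an extensional function on the basis;
   for finitely many simplices this is the vector space with basis simplices H p. *)
definition chain_space :: "hypergraph \<Rightarrow> int \<Rightarrow> (rat, nat set \<Rightarrow> rat) module" where
  "chain_space H p = ring.func_space class_ring (simplices H p)"

(* boundary_coeff A B is the coefficient of [B] in the boundary of the basis element [A]. *)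
definition boundary_coeff :: "nat set \<Rightarrow> nat set \<Rightarrow> rat" where
  "boundary_coeff A B =
     (\<Sum>j = 1..card A. if B = A - {vertex_at A j} then (-1) ^ (j - 1) else 0)"

definition boundary :: "hypergraph \<Rightarrow> int \<Rightarrow> (nat set \<Rightarrow> rat) \<Rightarrow> (nat set \<Rightarrow> rat)" where
  "boundary H p c =
     (\<lambda>B\<in>simplices H (p - 1). \<Sum>A\<in>simplices H p. c A * boundary_coeff A B)"

definition cycles :: "hypergraph \<Rightarrow> int \<Rightarrow> (nat set \<Rightarrow> rat) set" where
  "cycles H p = mod_hom.ker (chain_space H p) (chain_space H (p - 1)) (boundary H p)"

definition boundaries :: "hypergraph \<Rightarrow> int \<Rightarrow> (nat set \<Rightarrow> rat) set" where
  "boundaries H p = mod_hom.im (chain_space H (p + 1)) (boundary H (p + 1))"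

(* M / N on the additive cosets of N. The fields mult and one play no role in a module. *)
definition quotient_module ::
  "('a, 'm, 'x) module_scheme \<Rightarrow> 'm set \<Rightarrow> ('a, 'm set) module" where
  "quotient_module M N =
     \<lparr>carrier = a_rcosets\<^bsub>M\<^esub> N, monoid.mult = (\<lambda>X Y. N), one = N, zero = N,
      add = (\<lambda>X Y. X <+>\<^bsub>M\<^esub> Y),
      smult = (\<lambda>c X. \<Union>x\<in>X. N +>\<^bsub>M\<^esub> (c \<odot>\<^bsub>M\<^esub> x))\<rparr>"

definition homology :: "hypergraph \<Rightarrow> int \<Rightarrow> (rat, (nat set \<Rightarrow> rat) set) module" where
  "homology H p = quotient_module ((chain_space H p)\<lparr>carrier := cycles H p\<rparr>) (boundaries H p)"

definition betti :: "hypergraph \<Rightarrow> int \<Rightarrow> nat" where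
  "betti H p = vectorspace.dim class_ring (homology H p)"

definition acyclic_partition :: "nat \<Rightarrow> nat \<Rightarrow> hypergraph list \<Rightarrow> bool" where
  "acyclic_partition r d Hs \<longleftrightarrow>
     homogeneous_partition r d Hs \<and>
     (\<forall>i<d. \<forall>k\<le>r. betti (Hs ! i) (int k - 1) = 0)"

definition Ed_partition :: "nat \<Rightarrow> nat \<Rightarrow> hypergraph list" where
  "Ed_partition r d = map (Omega r d) [1..<d + 1]"

end

theory Submission
  imports Defs "HOL-Computational_Algebra.Polynomial"
begin

text \<open>
  Everything rests on the injectivity of the top boundary map of each hypergraph \<open>\<Omega>\<^sub>a\<close>. Fixing the
  vertices of a hyperedge outside \<open>S\<^sub>a\<close>, the remaining \<open>m\<close> vertices form a subset of \<open>S\<^sub>a\<close>, a complete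
  residue system modulo \<open>r\<close>, whose sum lies in a window of \<open>m\<close> consecutive residues; the boundary map
  is block triangular for this decomposition. A cycle \<open>z\<close> supported on such a window is killed by
  Fourier analysis: if \<open>z\<^sub>j\<close> is its part with sum \<open>j\<close> (counted from the start of the window), then the
  polynomial \<open>\<Sum>\<^sub>j z\<^sub>j X\<^sup>j\<close> takes at an \<open>r\<close>-th root of unity a value that is a cycle for a boundary
  map twisted by a character. Hence its Fourier coefficient at \<open>m\<close> distinct characters has \<open>m\<close>
  distinct roots, but degree less than \<open>m\<close>.

  Injectivity bounds the number of hyperedges of each \<open>\<Omega>\<^sub>a\<close> by the dimension \<open>rd - 1\<close> choose \<open>r - 1\<close>
  of the space of cycles of the full skeleton. As these bounds add up to the number of all hyperedges,
  they are equalities, and every such cycle bounds. Below that dimension the skeleton is complete and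
  therefore a cone.
\<close>

section \<open>Boundaries of functions on finite sets\<close>

text \<open>The oriented incidence number of a face \<open>B\<close> in \<open>insert v B\<close>, as in
  \<open>boundary_coeff\<close>, and the boundary operator of the full simplex on \<open>V\<close>; a chain is a function
  vanishing off its simplices.\<close>

definition face_sign :: "nat set \<Rightarrow> nat \<Rightarrow> 'a::comm_ring_1" where
  "face_sign B v = (-1) ^ card {y\<in>B. y < v}"

definition bdry :: "nat set \<Rightarrow> (nat set \<Rightarrow> 'a::comm_ring_1) \<Rightarrow> nat set \<Rightarrow> 'a" where
  "bdry V f B = (\<Sum>v\<in>V - B. face_sign B v * f (insert v B))"

lemma of_rat_face_sign [simp]: "of_rat (face_sign B v) = face_sign B v"
  unfolding face_sign_def of_rat_power of_rat_minus of_rat_1 ..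

lemma face_sign_insert:
  assumes "finite B" "w \<notin> B"
  shows "face_sign (insert w B) v = (if w < v then - face_sign B v else face_sign B v)"
proof -
  have "{y \<in> insert w B. y < v} = (if w < v then insert w {y\<in>B. y < v} else {y\<in>B. y < v})"
    by auto
  then show ?thesis using assms by (simp add: face_sign_def)
qed

text \<open>The smaller of the two vertices is counted in the sign of the larger one and not
  conversely, so exactly one of the two products picks up an extra minus sign.\<close>

lemma face_sign_swap:
  assumes "finite B" "v \<notin> B" "w \<notin> B" "v \<noteq> w"
  shows "face_sign B v * face_sign (insert v B) w = - (face_sign B w * face_sign (insert w B) v)"
proof (cases "v < w")
  case True
  then have "\<not> w < v" by simp
  with True show ?thesis using assms by (simp add: face_sign_insert[OF assms(1,2)] face_sign_insert[OF assms(1,3)])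
next
  case False
  with assms have "w < v" by simp
  with False show ?thesis using assms by (simp add: face_sign_insert[OF assms(1,2)] face_sign_insert[OF assms(1,3)])
qed

lemma bdry_cong:
  assumes "\<And>v. v \<in> V \<Longrightarrow> v \<notin> B \<Longrightarrow> f (insert v B) = g (insert v B)"
  shows "bdry V f B = bdry V g B"
  unfolding bdry_def using assms by (intro sum.cong) auto

lemma bdry_bdry:
  fixes f :: "nat set \<Rightarrow> 'a::field_char_0"
  assumes "finite V" "finite B"
  shows "bdry V (bdry V f) B = 0"
proof -
  \<comment> \<open>Zero on the diagonal, so that both indices range over the same set
    \<open>V - B\<close> and antisymmetry makes the double sum its own negative.\<close>
  let ?g = "\<lambda>v w. if v \<noteq> w then face_sign B v * face_sign (insert v B) w * f (insert v (insert w B)) else 0"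
  have eq: "bdry V (bdry V f) B = (\<Sum>v\<in>V - B. \<Sum>w\<in>V - B. ?g v w)"
    unfolding bdry_def
  proof (intro sum.cong refl)
    fix v assume v: "v \<in> V - B"
    have "face_sign B v * (\<Sum>w\<in>V - insert v B. face_sign (insert v B) w * f (insert w (insert v B)))
        = (\<Sum>w\<in>V - insert v B. ?g v w)"
      unfolding sum_distrib_left
    proof (intro sum.cong refl)
      fix w assume "w \<in> V - insert v B"
      then show "face_sign B v * (face_sign (insert v B) w * f (insert w (insert v B))) = ?g v w"
        by (simp only: insert_commute[of w v] mult.assoc) auto
    qed
    also have "\<dots> = (\<Sum>w\<in>V - B. ?g v w)"
      using assms by (intro sum.mono_neutral_left) auto
    finally show "face_sign B v * (\<Sum>w\<in>V - insert v B. face_sign (insert v B) w * f (insert w (insert v B)))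
        = (\<Sum>w\<in>V - B. ?g v w)" .
  qed
  have anti: "?g w v = - ?g v w" if "v \<in> V - B" "w \<in> V - B" for v w
  proof (cases "v = w")
    case False
    have "face_sign B w * face_sign (insert w B) v = (- (face_sign B v * face_sign (insert v B) w) :: 'a)"
      by (rule face_sign_swap) (use assms that False in auto)
    with False not_sym[OF False] show ?thesis
      by (simp only: insert_commute[of w v] simp_thms if_True mult_minus_left refl)
  qed simp
  have "(\<Sum>v\<in>V - B. \<Sum>w\<in>V - B. ?g v w) = (\<Sum>w\<in>V - B. \<Sum>v\<in>V - B. ?g v w)"
    by (rule sum.swap)
  also have "\<dots> = (\<Sum>w\<in>V - B. \<Sum>v\<in>V - B. - ?g w v)"
    by (intro sum.cong refl anti)
  also have "\<dots> = - (\<Sum>v\<in>V - B. \<Sum>w\<in>V - B. ?g v w)"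
    unfolding sum_negf ..
  finally have "2 * (\<Sum>v\<in>V - B. \<Sum>w\<in>V - B. ?g v w) = 0"
    unfolding mult_2 eq_neg_iff_add_eq_0 .
  then show ?thesis unfolding eq mult_eq_0_iff by simp
qed

section \<open>Cones over the least vertex\<close>

text \<open>The contracting homotopy with apex \<open>a\<close>; no sign occurs because the apex is
  the least vertex wherever it is used.\<close>

definition cone :: "nat \<Rightarrow> (nat set \<Rightarrow> 'a::comm_ring_1) \<Rightarrow> nat set \<Rightarrow> 'a" where
  "cone a f A = (if a \<in> A then f (A - {a}) else 0)"

text \<open>The homotopy identity, face by face: in the boundary at \<open>B - {a}\<close> the
  vertex \<open>a\<close> itself contributes \<open>f B\<close>, and for any other vertex the
  absence of \<open>a\<close> below it flips the sign.\<close>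

lemma bdry_remove_min:
  fixes f :: "nat set \<Rightarrow> 'a::comm_ring_1"
  assumes "finite V" "finite B" "a \<in> B" "a \<in> V" "\<And>v. v \<in> V \<Longrightarrow> a \<le> v" "B \<subseteq> V"
  shows "bdry V f (B - {a}) = f B - bdry V (cone a f) B"
proof -
  have 1: "V - (B - {a}) = insert a (V - B)" using assms by auto
  have e: "card {y \<in> B - {a}. y < a} = 0" using assms(5,6) by (force simp: card_eq_0_iff)
  have e: "face_sign (B - {a}) a = (1 :: 'a)" unfolding face_sign_def e by simp
  have s: "face_sign (B - {a}) v = (- face_sign B v :: 'a)" if "v \<in> V - B" for v
    using face_sign_insert[of "B - {a}" a v, where 'a='a] assms that
    by (auto simp: insert_absorb le_less)
  have "bdry V f (B - {a}) = f B + (\<Sum>v\<in>V - B. face_sign (B - {a}) v * f (insert v (B - {a})))"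
    unfolding bdry_def 1 using assms by (subst sum.insert) (auto simp: e insert_absorb)
  also have "(\<Sum>v\<in>V - B. face_sign (B - {a}) v * f (insert v (B - {a}))) = - bdry V (cone a f) B"
    unfolding bdry_def sum_negf[symmetric]
  proof (intro sum.cong refl)
    fix v assume v: "v \<in> V - B"
    with assms have "insert v B - {a} = insert v (B - {a})" by auto
    then show "face_sign (B - {a}) v * f (insert v (B - {a})) = - (face_sign B v * cone a f (insert v B))"
      using v assms s[OF v] by (simp add: cone_def)
  qed
  finally show ?thesis by simp
qed

text \<open>For \<open>a \<in> B\<close> this is the homotopy identity with vanishing boundary term.
  For \<open>a \<notin> B\<close> the only coface of \<open>B\<close> on which the cone can be
  nonzero is \<open>insert a B\<close>.\<close>

lemma bdry_cone:
  fixes f :: "nat set \<Rightarrow> 'a::comm_ring_1"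
  assumes "finite V" "B \<subseteq> V" "a \<in> V" "\<And>v. v \<in> V \<Longrightarrow> a \<le> v"
    and cyc: "a \<in> B \<Longrightarrow> bdry V f (B - {a}) = 0"
  shows "bdry V (cone a f) B = f B"
proof (cases "a \<in> B")
  case True
  with bdry_remove_min[of V B a f] assms show ?thesis by (auto simp: finite_subset)
next
  case False
  have e: "card {y \<in> B. y < a} = 0" using assms(2,4) by (force simp: card_eq_0_iff)
  have "bdry V (cone a f) B = (\<Sum>v\<in>{a}. face_sign B v * cone a f (insert v B))"
    unfolding bdry_def using assms False
    by (intro sum.mono_neutral_right) (auto simp: cone_def)
  also have "\<dots> = f B" using False by (simp add: face_sign_def cone_def e)
  finally show ?thesis .
qed

text \<open>A cycle is the boundary of its own cone, and at \<open>insert v B\<close> the cone reads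
  the value at a set without \<open>a\<close>. Hence cycles are determined by the faces avoiding the
  least vertex, which is what the later dimension count exploits.\<close>

lemma cycle_eq_0I:
  fixes f :: "nat set \<Rightarrow> 'a::comm_ring_1"
  assumes "finite V" "a \<in> V" "\<And>v. v \<in> V \<Longrightarrow> a \<le> v"
    and cyc: "\<And>B. B \<subseteq> V \<Longrightarrow> Suc (card B) = m \<Longrightarrow> bdry V f B = 0"
    and z: "\<And>B. B \<subseteq> V \<Longrightarrow> card B = m \<Longrightarrow> a \<notin> B \<Longrightarrow> f B = 0"
    and B: "B \<subseteq> V" "card B = m"
  shows "f B = 0"
proof (cases "a \<in> B")
  case True
  have fin: "finite B" using assms finite_subset by auto
  have "f B = bdry V (cone a f) B"
  proof (rule bdry_cone[symmetric])
    show "bdry V f (B - {a}) = 0"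
      using B True fin card_Suc_Diff1[of B a] by (intro cyc) auto
  qed (use assms in auto)
  also have "\<dots> = 0"
    unfolding bdry_def
  proof (intro sum.neutral ballI)
    fix v assume v: "v \<in> V - B"
    have "f (insert v B - {a}) = 0"
      by (rule z) (use v True B fin in auto)
    then show "face_sign B v * cone a f (insert v B) = 0" by (simp add: cone_def)
  qed
  finally show ?thesis .
qed (use z B in auto)

section \<open>Square linear systems\<close>

text \<open>Gaussian elimination, one equation \<open>x\<close> per induction step; \<open>Y\<close>
  indexes the unknowns.\<close>

lemma homogeneous_system_nontrivial:
  fixes M :: "'y \<Rightarrow> 'x \<Rightarrow> 'a::field"
  assumes "finite X" "finite Y" "card X < card Y"
  shows "\<exists>c. (\<exists>y\<in>Y. c y \<noteq> 0) \<and> (\<forall>x\<in>X. (\<Sum>y\<in>Y. c y * M y x) = 0)"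
  using assms
proof (induction X arbitrary: Y M rule: finite_induct)
  case empty
  then have "Y \<noteq> {}" by auto
  then show ?case by (intro exI[of _ "\<lambda>_. 1"]) auto
next
  case (insert x X)
  show ?case
  proof (cases "\<forall>y\<in>Y. M y x = 0")
    case True
    have "card X < card Y" using insert.prems insert.hyps by simp
    from insert.IH[OF insert.prems(1) this, of M]
    obtain c where c: "\<exists>y\<in>Y. c y \<noteq> 0" "\<forall>x\<in>X. (\<Sum>y\<in>Y. c y * M y x) = 0" by blast
    moreover have "(\<Sum>y\<in>Y. c y * M y x) = 0"
      using True by simp
    ultimately show ?thesis by blast
  next
    case False
    then obtain y0 where y0: "y0 \<in> Y" "M y0 x \<noteq> 0" by auto
    \<comment> \<open>Equation \<open>x\<close> expresses the unknown at the pivot \<open>y0\<close>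
      through the others; substituting it into the remaining equations yields the coefficients
      passed to the induction hypothesis.\<close>
    define q where "q y = M y x / M y0 x" for y
    define Y' where "Y' = Y - {y0}"
    have Y': "finite Y'" "card X < card Y'" "Y = insert y0 Y'" "y0 \<notin> Y'"
      using insert.prems insert.hyps y0 by (auto simp: Y'_def)
    from insert.IH[OF Y'(1,2), of "\<lambda>y x'. M y x' - q y * M y0 x'"]
    obtain c where c: "\<exists>y\<in>Y'. c y \<noteq> 0"
      "\<And>x'. x' \<in> X \<Longrightarrow> (\<Sum>y\<in>Y'. c y * (M y x' - q y * M y0 x')) = 0" by blast
    define c' where "c' = c(y0 := - (\<Sum>y\<in>Y'. c y * q y))"
    have eq: "(\<Sum>y\<in>Y. c' y * M y x') = (\<Sum>y\<in>Y'. c y * (M y x' - q y * M y0 x'))" for x'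
    proof -
      have "(\<Sum>y\<in>Y'. c' y * M y x') = (\<Sum>y\<in>Y'. c y * M y x')"
        using Y'(4) by (intro sum.cong) (auto simp: c'_def)
      moreover have "(\<Sum>y\<in>Y'. c y * (M y x' - q y * M y0 x'))
          = (\<Sum>y\<in>Y'. c y * M y x') - (\<Sum>y\<in>Y'. c y * q y) * M y0 x'"
        unfolding sum_distrib_right sum_subtractf[symmetric]
        by (intro sum.cong refl) (simp add: algebra_simps)
      moreover have "c' y0 = - (\<Sum>y\<in>Y'. c y * q y)"
        by (simp add: c'_def)
      ultimately show ?thesis
        unfolding Y'(3) sum.insert[OF Y'(1,4)] by simp
    qed
    have "(\<Sum>y\<in>Y'. c y * (M y x - q y * M y0 x)) = 0"
      using y0 by (simp add: q_def)
    moreover have "\<exists>y\<in>Y. c' y \<noteq> 0" using c(1) Y' by (auto simp: c'_def)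
    ultimately have "\<forall>x'\<in>insert x X. (\<Sum>y\<in>Y. c' y * M y x') = 0"
      using c(2) by (simp only: eq) blast
    with \<open>\<exists>y\<in>Y. c' y \<noteq> 0\<close> show ?thesis by blast
  qed
qed

lemma injective_system_card_le:
  fixes M :: "'y \<Rightarrow> 'x \<Rightarrow> 'a::field"
  assumes "finite X" "finite Y"
    and "\<And>c y. (\<And>x. x \<in> X \<Longrightarrow> (\<Sum>y\<in>Y. c y * M y x) = 0) \<Longrightarrow> y \<in> Y \<Longrightarrow> c y = 0"
  shows "card Y \<le> card X"
proof (rule ccontr)
  assume "\<not> card Y \<le> card X"
  with homogeneous_system_nontrivial[OF assms(1,2), of M]
  obtain c y where "y \<in> Y" "c y \<noteq> 0" "\<forall>x\<in>X. (\<Sum>y\<in>Y. c y * M y x) = 0"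
    unfolding not_le by blast
  with assms(3)[of c y] show False by blast
qed

text \<open>The right-hand side \<open>b\<close> is adjoined as one more unknown, indexed by
  \<open>None\<close>. There are then more unknowns than equations, and dividing a nontrivial
  solution by minus its entry at \<open>None\<close> solves the system.\<close>

lemma injective_square_system_solvable:
  fixes M :: "'y \<Rightarrow> 'x \<Rightarrow> 'a::field"
  assumes fin: "finite X" "finite Y" and card: "card Y = card X"
    and inj: "\<And>c y. (\<And>x. x \<in> X \<Longrightarrow> (\<Sum>y\<in>Y. c y * M y x) = 0) \<Longrightarrow> y \<in> Y \<Longrightarrow> c y = 0"
  shows "\<exists>c. \<forall>x\<in>X. (\<Sum>y\<in>Y. c y * M y x) = b x"
proof -
  define N where "N = (\<lambda>y'. case y' of None \<Rightarrow> b | Some y \<Rightarrow> M y)"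
  have sum: "(\<Sum>y'\<in>insert None (Some ` Y). g y') = g None + (\<Sum>y\<in>Y. g (Some y))"
    for g :: "'y option \<Rightarrow> 'a"
  proof -
    have "(\<Sum>y'\<in>insert None (Some ` Y). g y') = g None + sum g (Some ` Y)"
      using fin by (intro sum.insert) auto
    then show ?thesis by (simp add: sum.reindex)
  qed
  have "card X < card (insert None (Some ` Y))"
  proof -
    have "card (Some ` Y) = card Y" by (intro card_image) simp
    moreover have "None \<notin> Some ` Y" "finite (Some ` Y)" using fin by auto
    ultimately show ?thesis using card by simp
  qed
  from homogeneous_system_nontrivial[OF fin(1) _ this, of N] fin(2)
  obtain c where c: "\<exists>y'\<in>insert None (Some ` Y). c y' \<noteq> 0"
    and eq': "\<forall>x\<in>X. (\<Sum>y'\<in>insert None (Some ` Y). c y' * N y' x) = 0"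
    by blast
  have eq: "c None * b x + (\<Sum>y\<in>Y. c (Some y) * M y x) = 0" if "x \<in> X" for x
    using eq' that by (simp add: sum N_def)
  \<comment> \<open>Otherwise the remaining entries solve the homogeneous system and vanish by
    injectivity.\<close>
  have ne: "c None \<noteq> 0"
  proof
    assume "c None = 0"
    with eq have "\<And>y. y \<in> Y \<Longrightarrow> c (Some y) = 0"
      by (intro inj[of "\<lambda>y. c (Some y)"]) simp_all
    with c \<open>c None = 0\<close> show False by blast
  qed
  show ?thesis
  proof (rule exI[of _ "\<lambda>y. - inverse (c None) * c (Some y)"], rule ballI)
    fix x assume "x \<in> X"
    have "(\<Sum>y\<in>Y. - inverse (c None) * c (Some y) * M y x)
        = - inverse (c None) * (\<Sum>y\<in>Y. c (Some y) * M y x)"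
      unfolding sum_distrib_left mult.assoc ..
    also have "\<dots> = - inverse (c None) * (- (c None * b x))"
      unfolding minus_unique[OF eq[OF \<open>x \<in> X\<close>]] ..
    also have "\<dots> = b x"
      unfolding minus_mult_minus mult.assoc[symmetric] left_inverse[OF ne] mult_1 ..
    finally show "(\<Sum>y\<in>Y. - inverse (c None) * c (Some y) * M y x) = b x" .
  qed
qed

section \<open>Fourier transforms of alternating functions\<close>

text \<open>The sign of the permutation sorting a list, and 0 if an entry repeats; multiplying a function of
  sets by it gives an alternating function of lists.\<close>

fun list_sign :: "nat list \<Rightarrow> 'a::comm_ring_1" where
  "list_sign [] = 1"
| "list_sign (x # xs) = (if x \<in> set xs then 0 else face_sign (set xs) x * list_sign xs)"

lemma list_sign_eq_0_iff: "list_sign xs = (0 :: 'a::idom) \<longleftrightarrow> \<not> distinct xs"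
  by (induction xs) (auto simp: face_sign_def)

text \<open>Only exchanges of neighbours are demanded; they generate all permutations.\<close>

definition alternating :: "(nat list \<Rightarrow> 'a::comm_ring_1) \<Rightarrow> bool" where
  "alternating g \<longleftrightarrow> (\<forall>us x y vs. g (us @ x # y # vs) = - g (us @ y # x # vs))"

lemma alternating_Cons: "alternating g \<Longrightarrow> alternating (\<lambda>xs. g (x # xs))"
  unfolding alternating_def by (metis (no_types) append_Cons)

lemma alternating_mult:
  assumes "alternating g" "\<And>us x y vs. h (us @ x # y # vs) = h (us @ y # x # vs)"
  shows "alternating (\<lambda>xs. g xs * h xs)"
  unfolding alternating_def
proof (intro allI)
  fix us x y vs
  have "g (us @ x # y # vs) = - g (us @ y # x # vs)"
    using assms(1) unfolding alternating_def by blast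
  then show "g (us @ x # y # vs) * h (us @ x # y # vs) = - (g (us @ y # x # vs) * h (us @ y # x # vs))"
    by (simp only: assms(2)[of us x y vs] mult_minus_left)
qed

text \<open>At the head of the list this is \<open>face_sign_swap\<close>; entries further left see
  only the set of entries behind them, which the exchange preserves.\<close>

lemma list_sign_swap: "list_sign (us @ x # y # vs) = - (list_sign (us @ y # x # vs) :: 'a::comm_ring_1)"
proof (induction us)
  case Nil
  show ?case
  proof (cases "x \<noteq> y \<and> x \<notin> set vs \<and> y \<notin> set vs")
    case True
    have "face_sign (set vs) y * face_sign (insert y (set vs)) x * list_sign vs
        = - (face_sign (set vs) x * face_sign (insert x (set vs)) y) * (list_sign vs :: 'a)"
      using True by (subst face_sign_swap) auto
    with True show ?thesis by (simp add: mult_ac)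
  qed auto
next
  case (Cons u us)
  have eq: "set (us @ x # y # vs) = set (us @ y # x # vs)" by auto
  show ?case unfolding append_Cons list_sign.simps eq Cons.IH by simp
qed

lemma alternating_list_sign: "alternating list_sign"
  unfolding alternating_def using list_sign_swap by blast

text \<open>The discrete Fourier transform in every list position separately: when
  \<open>q ^ r = 1\<close>, the map from \<open>x\<close> to \<open>q ^ x\<close> is a character
  modulo \<open>r\<close>, and \<open>qs\<close> holds one character per position.\<close>

fun fourier :: "nat set \<Rightarrow> (nat list \<Rightarrow> complex) \<Rightarrow> complex list \<Rightarrow> complex" where
  "fourier S g [] = g []"
| "fourier S g (q # qs) = (\<Sum>x\<in>S. q ^ x * fourier S (\<lambda>xs. g (x # xs)) qs)"

lemma fourier_cong:
  assumes "\<And>xs. set xs \<subseteq> S \<Longrightarrow> length xs = length qs \<Longrightarrow> g xs = h xs"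
  shows "fourier S g qs = fourier S h qs"
  using assms
proof (induction qs arbitrary: g h)
  case (Cons q qs)
  have "fourier S (\<lambda>xs. g (x # xs)) qs = fourier S (\<lambda>xs. h (x # xs)) qs" if "x \<in> S" for x
    using that by (intro Cons.IH Cons.prems) auto
  then show ?case by simp
qed simp

lemma fourier_scale: "fourier S (\<lambda>xs. c * g xs) qs = c * fourier S g qs"
  by (induction qs arbitrary: g) (simp_all add: sum_distrib_left mult_ac)

lemma fourier_zero: "fourier S (\<lambda>_. 0) qs = 0"
  by (induction qs) simp_all

lemma fourier_sum: "fourier S (\<lambda>xs. \<Sum>i\<in>I. g i xs) qs = (\<Sum>i\<in>I. fourier S (g i) qs)"
proof (induction qs arbitrary: g)
  case (Cons q qs)
  show ?case
    unfolding fourier.simps Cons.IH sum_distrib_left by (rule sum.swap)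
qed simp

lemma fourier_uminus: "fourier S (\<lambda>xs. - g xs) qs = - fourier S g qs"
  using fourier_scale[of S "-1" g qs] by (simp only: mult_minus1)

text \<open>Exchanging two neighbouring characters amounts to exchanging the two summation
  variables, where alternation supplies the sign.\<close>

lemma fourier_swap:
  assumes "alternating g"
  shows "fourier S g (us @ p # q # vs) = - fourier S g (us @ q # p # vs)"
  using assms
proof (induction us arbitrary: g)
  case Nil
  have *: "(\<lambda>xs. g (x # y # xs)) = (\<lambda>xs. - g (y # x # xs))" for x y
  proof
    show "g (x # y # xs) = - g (y # x # xs)" for xs
      using spec[OF Nil[unfolded alternating_def], of "[]"] unfolding append_Nil by blast
  qed
  have "fourier S g (p # q # vs) = (\<Sum>x\<in>S. \<Sum>y\<in>S. p ^ x * (q ^ y * fourier S (\<lambda>xs. g (x # y # xs)) vs))"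
    by (simp add: sum_distrib_left)
  also have "\<dots> = (\<Sum>x\<in>S. \<Sum>y\<in>S. - (q ^ y * (p ^ x * fourier S (\<lambda>xs. g (y # x # xs)) vs)))"
  proof (intro sum.cong refl)
    fix x y
    have "fourier S (\<lambda>xs. g (x # y # xs)) vs = - fourier S (\<lambda>xs. g (y # x # xs)) vs"
      unfolding arg_cong[OF *[of x y], of "\<lambda>h. fourier S h vs"] by (rule fourier_uminus)
    then show "p ^ x * (q ^ y * fourier S (\<lambda>xs. g (x # y # xs)) vs)
        = - (q ^ y * (p ^ x * fourier S (\<lambda>xs. g (y # x # xs)) vs))"
      by (simp only: mult_minus_right mult.left_commute)
  qed
  also have "\<dots> = (\<Sum>y\<in>S. \<Sum>x\<in>S. - (q ^ y * (p ^ x * fourier S (\<lambda>xs. g (y # x # xs)) vs)))"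
    by (rule sum.swap)
  also have "\<dots> = - fourier S g (q # p # vs)"
    unfolding fourier.simps sum_distrib_left sum_negf ..
  finally show ?case by simp
next
  case (Cons u us)
  show ?case
    unfolding append_Cons fourier.simps Cons.IH[OF alternating_Cons[OF Cons.prems]]
    unfolding mult_minus_right sum_negf ..
qed

lemma fourier_move_to_front:
  assumes "alternating g"
  shows "fourier S g (us @ q # vs) = (-1) ^ length us * fourier S g (q # us @ vs)"
proof (induction us arbitrary: vs rule: rev_induct)
  case (snoc u us)
  have "fourier S g ((us @ [u]) @ q # vs) = fourier S g (us @ u # q # vs)" by simp
  also have "\<dots> = - fourier S g (us @ q # u # vs)" using assms by (rule fourier_swap)
  also have "\<dots> = - ((-1) ^ length us * fourier S g (q # us @ u # vs))" by (simp only: snoc.IH)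
  also have "\<dots> = (-1) ^ length (us @ [u]) * fourier S g (q # (us @ [u]) @ vs)" by simp
  finally show ?case .
qed simp

text \<open>Two equal characters, brought side by side to the front, can be exchanged, which equates
  the transform with its negative.\<close>

lemma fourier_not_distinct:
  assumes "alternating g" "\<not> distinct qs"
  shows "fourier S g qs = 0"
proof -
  from not_distinct_decomp[OF assms(2)] obtain us vs ws q
    where "qs = us @ [q] @ vs @ [q] @ ws" by blast
  then have qs: "qs = us @ q # (vs @ q # ws)" by simp
  have "fourier S g (q # q # us @ vs @ ws) = - fourier S g (q # q # us @ vs @ ws)"
    using fourier_swap[OF assms(1), of S "[]" q q "us @ vs @ ws"] by (simp only: append_Nil)
  then have "2 * fourier S g (q # q # us @ vs @ ws) = 0"
    unfolding mult_2 eq_neg_iff_add_eq_0 .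
  then have 0: "fourier S g (q # q # us @ vs @ ws) = 0" by simp
  have "fourier S g (q # us @ vs @ q # ws) = (-1) ^ length (q # us @ vs) * fourier S g (q # q # us @ vs @ ws)"
    using fourier_move_to_front[OF assms(1), of S "q # us @ vs" q ws] by simp
  then show ?thesis
    unfolding qs fourier_move_to_front[OF assms(1), of S us] 0 by simp
qed

section \<open>Polynomial roots and Fourier inversion\<close>

lemma coefficients_eq_0:
  fixes a :: "nat \<Rightarrow> 'a::{comm_ring_1,ring_no_zero_divisors}"
  assumes "\<And>x. x \<in> R \<Longrightarrow> (\<Sum>j<m. a j * x ^ j) = 0" "m \<le> card R" "j < m"
  shows "a j = 0"
proof -
  define p where "p = (\<Sum>j<m. monom (a j) j)"
  have coeff: "coeff p i = (if i < m then a i else 0)" for i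
    by (simp add: p_def coeff_sum)
  have "degree p \<le> m - 1"
    by (rule degree_le) (use assms(3) in \<open>auto simp: coeff\<close>)
  then have "degree p < card R" using assms(2,3) by linarith
  moreover have "poly p x = poly 0 x" if "x \<in> R" for x
    using assms(1)[OF that] by (simp add: p_def poly_sum poly_monom)
  moreover have "degree (0 :: 'a poly) < card R" using assms(2,3) by simp
  ultimately have "p = 0" by (intro poly_eqI_degree[of R p 0])
  with coeff[of j] assms(3) show ?thesis by simp
qed

lemma root_of_unity_power_mod:
  fixes q :: "'a::monoid_mult"
  assumes "q ^ r = 1"
  shows "q ^ (n mod r) = q ^ n"
proof -
  have "q ^ n = q ^ (r * (n div r) + n mod r)" by simp
  also have "\<dots> = q ^ (n mod r)" unfolding power_add power_mult assms by simp
  finally show ?thesis ..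
qed

text \<open>Positions are inverted one at a time: as a function of the first character the transform
  agrees on the \<open>r\<close> roots of unity with a polynomial of degree below \<open>r\<close>.
  Its coefficients therefore vanish, and residues separate the elements of \<open>S\<close>.\<close>

lemma fourier_inversion:
  assumes r: "r \<ge> 1" and fin: "finite S" and inj: "inj_on (\<lambda>x. x mod r) S"
    and fourier: "\<And>qs. length qs = m \<Longrightarrow> (\<forall>q\<in>set qs. q ^ r = 1) \<Longrightarrow> fourier S g qs = 0"
    and xs: "length xs = m" "set xs \<subseteq> S"
  shows "g xs = 0"
  using fourier xs
proof (induction m arbitrary: g xs)
  case 0
  then show ?case using "0.prems"(1)[of "[]"] by simp
next
  case (Suc m)
  obtain x ys where xs: "xs = x # ys" "length ys = m" "x \<in> S" "set ys \<subseteq> S"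
    using Suc.prems(2,3) by (cases xs) auto
  have ft0: "fourier S (\<lambda>ys. g (x # ys)) qs = 0" if qs: "length qs = m" "\<forall>q\<in>set qs. q ^ r = 1" for qs
  proof -
    define a where "a y = fourier S (\<lambda>ys. g (y # ys)) qs" for y
    \<comment> \<open>Grouping by residues reduces the exponents below \<open>r\<close>, so that the
      degree stays below the number of roots of unity.\<close>
    define b where "b j = (\<Sum>y\<in>{y\<in>S. y mod r = j}. a y)" for j
    have "(\<Sum>j<r. b j * q ^ j) = 0" if "q \<in> {q. q ^ r = 1}" for q
    proof -
      have q: "q ^ y = q ^ (y mod r)" for y
        using root_of_unity_power_mod[of q r y] that by simp
      have "(\<Sum>j<r. b j * q ^ j) = (\<Sum>j<r. \<Sum>y\<in>{y\<in>S. y mod r = j}. q ^ y * a y)"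
        unfolding b_def sum_distrib_right
      proof (intro sum.cong refl)
        fix j y assume "y \<in> {y\<in>S. y mod r = j}"
        then show "a y * q ^ j = q ^ y * a y" by (subst q[of y]) simp
      qed
      also have "\<dots> = (\<Sum>y\<in>S. q ^ y * a y)"
        using r by (intro sum.group fin) auto
      also have "\<dots> = fourier S g (q # qs)" by (simp add: a_def)
      also have "\<dots> = 0" using that qs by (intro Suc.prems(1)) auto
      finally show ?thesis .
    qed
    note sum0 = this
    have card: "r \<le> card {q::complex. q ^ r = 1}"
      using card_roots_unity_eq[of r] r by simp
    have "x mod r < r" using r by simp
    then have b0: "b (x mod r) = 0"
      using coefficients_eq_0[of "{q. q ^ r = 1}" b r "x mod r"] sum0 card by blast
    have single: "{y\<in>S. y mod r = x mod r} = {x}"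
    proof (intro equalityI subsetI)
      fix y assume "y \<in> {y\<in>S. y mod r = x mod r}"
      then have y: "y mod r = x mod r" "y \<in> S" by simp_all
      show "y \<in> {x}" using inj_onD[OF inj y(1) y(2) xs(3)] by simp
    qed (use xs(3) in simp)
    have "a x = sum a {y\<in>S. y mod r = x mod r}"
      by (subst single) simp
    also have "\<dots> = 0" using b0 by (simp only: b_def)
    finally have "a x = 0" .
    then show ?thesis unfolding a_def .
  qed
  show ?case unfolding xs(1) by (rule Suc.IH[OF ft0 xs(2,4)])
qed

section \<open>Cycles supported on a window of residues\<close>

lemma alternating_list_sign_mult:
  fixes h :: "nat set \<Rightarrow> nat \<Rightarrow> 'a::comm_ring_1"
  shows "alternating (\<lambda>xs. list_sign xs * h (set xs) (sum_list xs))"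
proof (intro alternating_mult alternating_list_sign)
  fix us vs :: "nat list" and x y :: nat
  have "set (us @ x # y # vs) = set (us @ y # x # vs)"
    "sum_list (us @ x # y # vs) = sum_list (us @ y # x # vs)" by auto
  then show "h (set (us @ x # y # vs)) (sum_list (us @ x # y # vs))
      = h (set (us @ y # x # vs)) (sum_list (us @ y # x # vs))" by (simp only:)
qed

text \<open>With \<open>q\<close> in first position, the weight \<open>inverse q ^ x\<close> of the first entry \<open>x\<close> cancels the
  character value \<open>q ^ x\<close>, so the sum over \<open>x\<close> is a boundary coefficient.\<close>

lemma fourier_cycle_first:
  assumes r: "r \<ge> 1" and fin: "finite S" and q: "q ^ r = 1"
    and cyc: "\<And>B. B \<subseteq> S \<Longrightarrow> card B = length qs \<Longrightarrow> bdry S z B = 0"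
  shows "fourier S (\<lambda>xs. list_sign xs * (z (set xs) * inverse q ^ ((sum_list xs + c) mod r))) (q # qs) = 0"
proof -
  define X where "X = inverse q"
  have Xr: "X ^ r = 1" by (simp add: X_def power_inverse q)
  have "q \<noteq> 0" using q r by (auto simp: power_0_left)
  then have qX: "q ^ x * X ^ x = 1" for x
    unfolding X_def power_mult_distrib[symmetric] by simp
  have "fourier S (\<lambda>xs. list_sign xs * (z (set xs) * X ^ ((sum_list xs + c) mod r))) (q # qs)
      = (\<Sum>x\<in>S. fourier S (\<lambda>xs. X ^ (sum_list xs + c) * (list_sign (x # xs) * z (insert x (set xs)))) qs)"
    unfolding fourier.simps
  proof (intro sum.cong refl)
    fix x
    have "q ^ x * (list_sign (x # xs) * (z (set (x # xs)) * X ^ ((sum_list (x # xs) + c) mod r)))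
        = X ^ (sum_list xs + c) * (list_sign (x # xs) * z (insert x (set xs)))" for xs
    proof -
      have "q ^ x * (list_sign (x # xs) * (z (set (x # xs)) * X ^ ((sum_list (x # xs) + c) mod r)))
          = (q ^ x * X ^ x) * (X ^ (sum_list xs + c) * (list_sign (x # xs) * z (insert x (set xs))))"
        unfolding root_of_unity_power_mod[OF Xr] sum_list.Cons add.assoc power_add list.set(2)
        by (simp only: mult_ac)
      then show ?thesis unfolding qX by (simp only: mult_1)
    qed
    then show "q ^ x * fourier S (\<lambda>xs. list_sign (x # xs) * (z (set (x # xs)) * X ^ ((sum_list (x # xs) + c) mod r))) qs
        = fourier S (\<lambda>xs. X ^ (sum_list xs + c) * (list_sign (x # xs) * z (insert x (set xs)))) qs"
      unfolding fourier_scale[symmetric] by (intro fourier_cong)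
  qed
  also have "\<dots> = fourier S (\<lambda>xs. \<Sum>x\<in>S. X ^ (sum_list xs + c) * (list_sign (x # xs) * z (insert x (set xs)))) qs"
    unfolding fourier_sum ..
  also have "\<dots> = fourier S (\<lambda>_. 0) qs"
  proof (rule fourier_cong)
    fix xs :: "nat list" assume xs: "set xs \<subseteq> S" "length xs = length qs"
    \<comment> \<open>Prepending \<open>x\<close> multiplies \<open>list_sign xs\<close> by the
      incidence number of \<open>x\<close>, and repeated entries contribute 0; what remains is
      \<open>list_sign xs\<close> times a boundary value of the cycle.\<close>
    have "(\<Sum>x\<in>S. list_sign (x # xs) * z (insert x (set xs))) = 0"
    proof (cases "distinct xs")
      case True
      have "(\<Sum>x\<in>S. list_sign (x # xs) * z (insert x (set xs)))
          = (\<Sum>x\<in>S - set xs. list_sign (x # xs) * z (insert x (set xs)))"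
        using fin by (intro sum.mono_neutral_right) auto
      also have "\<dots> = (\<Sum>x\<in>S - set xs. list_sign xs * (face_sign (set xs) x * z (insert x (set xs))))"
      proof (intro sum.cong refl)
        fix x assume "x \<in> S - set xs"
        then have "x \<notin> set xs" by simp
        then show "list_sign (x # xs) * z (insert x (set xs)) = list_sign xs * (face_sign (set xs) x * z (insert x (set xs)))"
          by (simp only: list_sign.simps if_False mult_ac)
      qed
      also have "\<dots> = list_sign xs * bdry S z (set xs)"
        unfolding bdry_def sum_distrib_left ..
      also have "bdry S z (set xs) = 0"
        using xs distinct_card[OF True] by (intro cyc) simp_all
      finally show ?thesis by simp
    next
      case False
      have "list_sign (x # xs) = (0 :: complex)" for x
        unfolding list_sign_eq_0_iff using False by simp
      then show ?thesis by (simp only: mult_zero_left sum.neutral_const)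
    qed
    then show "(\<Sum>x\<in>S. X ^ (sum_list xs + c) * (list_sign (x # xs) * z (insert x (set xs)))) = 0"
      unfolding sum_distrib_left[symmetric] by (simp only: mult_zero_right)
  qed
  also have "\<dots> = 0" by (rule fourier_zero)
  finally show ?thesis unfolding X_def .
qed

text \<open>For fixed \<open>qs\<close>, the polynomial in \<open>X\<close> whose \<open>j\<close>-th coefficient is the transform of the part with
  \<open>(sum + c) mod r = j\<close> has degree below \<open>m\<close>, yet it vanishes at the \<open>m\<close> points \<open>inverse q\<close> with
  \<open>q \<in> set qs\<close>.\<close>

lemma window_cycle_eq_0:
  fixes z :: "nat set \<Rightarrow> complex"
  assumes r: "r \<ge> 1" and fin: "finite S" and inj: "inj_on (\<lambda>x. x mod r) S"
    and supp: "\<And>T. T \<subseteq> S \<Longrightarrow> card T = m \<Longrightarrow> z T \<noteq> 0 \<Longrightarrow> (\<Sum>T + c) mod r < m"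
    and cyc: "\<And>B. B \<subseteq> S \<Longrightarrow> Suc (card B) = m \<Longrightarrow> bdry S z B = 0"
    and T: "T \<subseteq> S" "card T = m"
  shows "z T = 0"
proof (rule ccontr)
  assume nz: "z T \<noteq> 0"
  \<comment> \<open>\<open>h j\<close> cuts out the part of \<open>z\<close> with shifted sum
    \<open>j\<close>, and \<open>g j\<close> is its alternating extension to lists.\<close>
  define h where "h j xs = (if (sum_list xs + c) mod r = j then z (set xs) else 0)" for j xs
  define g where "g j xs = list_sign xs * h j xs" for j xs
  have alt: "alternating (g j)" for j
    unfolding g_def h_def
    by (rule alternating_list_sign_mult[of "\<lambda>A n. if (n + c) mod r = j then z A else 0"])
  have ft0: "fourier S (g j) qs = 0"
    if j: "j < m" and qs: "length qs = m" "\<forall>q\<in>set qs. q ^ r = 1" for j and qs :: "complex list"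
  \<comment> \<open>Repeated characters are settled by alternation alone; distinct ones provide the
    \<open>m\<close> distinct roots.\<close>
  proof (cases "distinct qs")
    case False
    show ?thesis by (rule fourier_not_distinct[OF alt False])
  next
    case True
    have zero: "(\<Sum>j<m. fourier S (g j) qs * X ^ j) = 0" if X: "X \<in> inverse ` set qs" for X
    proof -
      obtain q where q: "q \<in> set qs" "X = inverse q" using X by blast
      obtain us vs where split: "qs = us @ q # vs" using q(1) by (meson split_list)
      define G where "G xs = list_sign xs * (z (set xs) * X ^ ((sum_list xs + c) mod r))" for xs
      have "alternating G"
        unfolding G_def by (rule alternating_list_sign_mult[of "\<lambda>A n. z A * X ^ ((n + c) mod r)"])
      note front = fourier_move_to_front[OF this]
      have "(\<Sum>j<m. fourier S (g j) qs * X ^ j) = fourier S (\<lambda>xs. \<Sum>j<m. X ^ j * g j xs) qs"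
        unfolding fourier_sum fourier_scale by (simp only: mult.commute)
      also have "\<dots> = fourier S G qs"
      proof (rule fourier_cong)
        fix xs :: "nat list" assume xs: "set xs \<subseteq> S" "length xs = length qs"
        define k where "k = (sum_list xs + c) mod r"
        show "(\<Sum>j<m. X ^ j * g j xs) = G xs"
        proof (cases "list_sign xs * z (set xs) = 0")
          case True
          then have "list_sign xs = (0::complex) \<or> z (set xs) = 0" by simp
          then have "g j xs = 0" "G xs = 0" for j
            by (auto simp: g_def h_def G_def)
          then show ?thesis by simp
        next
          case False
          then have nz: "list_sign xs \<noteq> (0::complex)" "z (set xs) \<noteq> 0" by auto
          from nz(1) have d: "distinct xs" unfolding list_sign_eq_0_iff by simp
          \<comment> \<open>The window hypothesis: the one exponent \<open>k\<close> to which this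
            list contributes is among those summed over.\<close>
          have "k < m"
            using supp[OF xs(1) _ nz(2)] distinct_card[OF d] xs(2) qs(1) sum_list_distinct_conv_sum_set[OF d, of "\<lambda>x. x"]
            by (simp add: k_def)
          have "(\<Sum>j<m. X ^ j * g j xs) = (\<Sum>j\<in>{k}. X ^ j * g j xs)"
            using \<open>k < m\<close> by (intro sum.mono_neutral_right) (auto simp: g_def h_def k_def)
          also have "\<dots> = G xs" by (simp add: g_def h_def G_def k_def)
          finally show ?thesis .
        qed
      qed
      also have "\<dots> = (-1) ^ length us * fourier S G (q # us @ vs)"
        unfolding split by (rule front)
      also have "fourier S G (q # us @ vs) = 0"
        unfolding G_def q(2)
      proof (rule fourier_cycle_first[OF r fin])
        show "q ^ r = 1" using qs(2) q(1) by blast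
        show "bdry S z B = 0" if "B \<subseteq> S" "card B = length (us @ vs)" for B
          using that qs(1) split by (intro cyc) simp_all
      qed
      finally show ?thesis by simp
    qed
    have "card (inverse ` set qs) = m"
      using distinct_card[OF True] qs(1) by (subst card_image) (auto intro: inj_onI)
    then have card: "m \<le> card (inverse ` set qs)" by simp
    show ?thesis
      by (rule coefficients_eq_0[of "inverse ` set qs" "\<lambda>j. fourier S (g j) qs", OF zero card j])
  qed
  obtain xs where xs: "distinct xs" "set xs = T"
    using finite_distinct_list[OF finite_subset[OF T(1) fin]] by blast
  have len: "length xs = m" using distinct_card[OF xs(1)] xs(2) T(2) by simp
  have sum: "sum_list xs = \<Sum>T"
    using sum_list_distinct_conv_sum_set[OF xs(1), of "\<lambda>x. x"] xs(2) by simp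
  have "(sum_list xs + c) mod r < m" unfolding sum by (rule supp[OF T nz])
  from ft0[OF this] have "g ((sum_list xs + c) mod r) xs = 0"
    by (rule fourier_inversion[OF r fin inj _ len]) (use xs T in simp_all)
  moreover have "list_sign xs \<noteq> (0::complex)" unfolding list_sign_eq_0_iff using xs(1) by simp
  ultimately show False using nz xs(2) by (simp add: g_def h_def)
qed

section \<open>The hypergraphs Omega\<close>

lemma card_less_nth_sorted_list_of_set:
  fixes A :: "'a::linorder set"
  assumes "finite A" "i < card A"
  shows "card {y\<in>A. y < sorted_list_of_set A ! i} = i"
proof -
  let ?xs = "sorted_list_of_set A"
  have len: "length ?xs = card A" by simp
  have less: "?xs ! j < ?xs ! k" if "j < k" "k < card A" for j k
    using sorted_wrt_nth_less[OF strict_sorted_list_of_set[of A], of j k] that len by simp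
  have "{y\<in>A. y < ?xs ! i} = (!) ?xs ` {..<i}"
  proof (intro equalityI subsetI)
    fix y assume "y \<in> {y\<in>A. y < ?xs ! i}"
    then have y: "y \<in> A" "y < ?xs ! i" by simp_all
    have "y \<in> set ?xs" using y(1) assms(1) by simp
    then obtain j where j: "j < card A" "y = ?xs ! j" using len by (metis in_set_conv_nth)
    have "j < i"
    proof (rule ccontr)
      assume "\<not> j < i"
      then have "?xs ! i \<le> ?xs ! j" using less[of i j] j(1) by (cases "i = j") auto
      with y(2) j(2) show False by simp
    qed
    with j(2) show "y \<in> (!) ?xs ` {..<i}" by blast
  next
    fix y assume "y \<in> (!) ?xs ` {..<i}"
    then obtain j where j: "j < i" "y = ?xs ! j" by blast
    have "?xs ! j \<in> set ?xs" using j(1) assms len by (intro nth_mem) simp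
    then show "y \<in> {y\<in>A. y < ?xs ! i}" using less[OF j(1) assms(2)] j(2) assms(1) by simp
  qed
  moreover have "inj_on ((!) ?xs) {..<i}"
    using distinct_sorted_list_of_set[of A] assms(2) len by (intro inj_on_nth) auto
  ultimately show ?thesis by (simp add: card_image)
qed

lemma vertex_at_mem:
  assumes "finite A" "1 \<le> t" "t \<le> card A"
  shows "vertex_at A t \<in> A"
proof -
  have "sorted_list_of_set A ! (t - 1) \<in> set (sorted_list_of_set A)"
    using assms by (intro nth_mem) simp
  then show ?thesis using assms(1) by (simp add: vertex_at_def)
qed

text \<open>Links the sign \<open>(-1) ^ (j - 1)\<close> of \<open>boundary_coeff\<close> to the
  count of smaller vertices in \<open>face_sign\<close>.\<close>

lemma card_less_vertex_at:
  assumes "finite A" "1 \<le> t" "t \<le> card A"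
  shows "card {y\<in>A. y < vertex_at A t} = t - 1"
  unfolding vertex_at_def using assms by (intro card_less_nth_sorted_list_of_set) simp_all

lemma bij_betw_vertex_at:
  assumes "finite A"
  shows "bij_betw (vertex_at A) {1..card A} A"
proof (rule bij_betw_imageI)
  show inj: "inj_on (vertex_at A) {1..card A}"
  proof (rule inj_onI)
    fix s t assume st: "s \<in> {1..card A}" "t \<in> {1..card A}" "vertex_at A s = vertex_at A t"
    then have "s - 1 = t - 1"
      using card_less_vertex_at[OF assms, of s] card_less_vertex_at[OF assms, of t] by simp
    moreover have "1 \<le> s" "1 \<le> t" using st(1,2) by simp_all
    ultimately show "s = t" by linarith
  qed
  have "vertex_at A ` {1..card A} \<subseteq> A"
    using vertex_at_mem[OF assms] by auto
  moreover have "card (vertex_at A ` {1..card A}) = card A"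
    using inj by (simp add: card_image)
  ultimately show "vertex_at A ` {1..card A} = A"
    using assms by (simp add: card_subset_eq)
qed

section \<open>Residue windows and injectivity of the top boundary map\<close>

text \<open>If \<open>p\<close> vertices lie below the block and \<open>m\<close> in it, the block
  vertices occupy positions \<open>p + 1\<close> to \<open>p + m\<close>. So \<open>t - 1\<close>
  lies in a window of length \<open>m\<close> starting at \<open>p\<close>, and adding
  \<open>r - p\<close> makes the window start at 0 modulo \<open>r\<close>; truncation does no harm
  as \<open>p \<le> t - 1 < r\<close>.\<close>

lemma Omega_edge_window:
  assumes r: "r \<ge> 1" and e: "e \<in> edges (Omega r d a)"
  shows "(\<Sum>e + (r - card {y\<in>e. y < r * a - (r - 1)})) mod r < card (e \<inter> S_block r a)"
proof -
  define lo where "lo = r * a - (r - 1)"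
  define p where "p = card {y\<in>e. y < lo}"
  from e obtain t where e': "e \<subseteq> {1..r * d}" "card e = r" and t: "t \<in> {1..r}"
    and cong: "[\<Sum>e = t - 1] (mod r)" and v: "vertex_at e t \<in> S_block r a"
    unfolding Omega_def by auto
  have fin: "finite e" using e'(1) finite_subset by blast
  let ?v = "vertex_at e t"
  have lo: "lo \<le> ?v" using v by (simp add: S_block_def lo_def)
  have vt: "?v \<in> e" "card {y\<in>e. y < ?v} = t - 1"
    using vertex_at_mem[OF fin, of t] card_less_vertex_at[OF fin, of t] t e'(2) by simp_all
  have sub: "{y\<in>e. y < ?v} - {y\<in>e. y < lo} \<subseteq> e \<inter> S_block r a - {?v}"
    using v unfolding S_block_def lo_def by auto
  have le: "{y\<in>e. y < lo} \<subseteq> {y\<in>e. y < ?v}" using lo by auto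
  have "p \<le> t - 1" unfolding p_def vt(2)[symmetric] using le fin by (intro card_mono) simp_all
  have "t - 1 - p = card ({y\<in>e. y < ?v} - {y\<in>e. y < lo})"
    using card_Diff_subset[OF _ le] fin vt(2) by (simp add: p_def)
  also have "\<dots> \<le> card (e \<inter> S_block r a - {?v})"
    using fin sub by (intro card_mono) simp_all
  also have "\<dots> < card (e \<inter> S_block r a)"
    using fin v vt(1) by (intro card_Diff1_less) simp_all
  finally have less: "t - 1 - p < card (e \<inter> S_block r a)" .
  have "(\<Sum>e + (r - p)) mod r = (t - 1 + (r - p)) mod r"
    using cong unfolding cong_def by (metis mod_add_left_eq)
  also have "t - 1 + (r - p) = (t - 1 - p) + r"
  proof -
    have "1 \<le> t" "t \<le> r" using t by simp_all
    with \<open>p \<le> t - 1\<close> show ?thesis by linarith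
  qed
  also have "\<dots> mod r = t - 1 - p"
  proof -
    have "1 \<le> t" "t \<le> r" using t by simp_all
    then have "t - 1 - p < r" by linarith
    then show ?thesis by simp
  qed
  finally show ?thesis using less by (simp only: p_def lo_def)
qed

lemma S_block_subset:
  assumes "r \<ge> 1" "1 \<le> a" "a \<le> d"
  shows "S_block r a \<subseteq> {1..r * d}"
proof
  fix v assume "v \<in> S_block r a"
  then have v: "r * a - (r - 1) \<le> v" "v \<le> r * a" by (simp_all add: S_block_def)
  have "r * 1 \<le> r * a" using assms(2) by (rule mult_le_mono2)
  then have "1 \<le> v" using v(1) assms(1) by linarith
  moreover have "r * a \<le> r * d" using assms(3) by (rule mult_le_mono2)
  ultimately show "v \<in> {1..r * d}" using v(2) unfolding atLeastAtMost_iff by linarith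
qed

lemma inj_on_mod_S_block: "inj_on (\<lambda>x. x mod r) (S_block r a)"
proof -
  have "x = y" if "x \<in> S_block r a" "y \<in> S_block r a" "x mod r = y mod r" "x \<le> y" for x y
  proof -
    have "r dvd y - x" using that(3,4) by (metis mod_eq_dvd_iff_nat)
    \<comment> \<open>Elements of a block differ by less than \<open>r\<close>; for
      \<open>r = 0\<close> the block is \<open>{0}\<close>.\<close>
    moreover have "y - x < r \<or> r = 0" using that(1,2) by (auto simp: S_block_def)
    ultimately have "y - x = 0" using that(1,2) by (auto simp: S_block_def dest: dvd_imp_le)
    with that(4) show ?thesis by simp
  qed
  then show ?thesis by (metis inj_onI linear)
qed

text \<open>Take an edge \<open>e\<close> of the support with fewest vertices in the block \<open>S\<close>. Adding to a ridge a vertex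
  outside \<open>S\<close> would give an edge with fewer vertices in \<open>S\<close>, so with \<open>e - S\<close> fixed the cycle condition
  only involves subsets of \<open>S\<close>.\<close>

lemma Omega_top_cycle_eq_0:
  fixes z :: "nat set \<Rightarrow> rat"
  assumes r: "r \<ge> 1" and a: "1 \<le> a" "a \<le> d"
    and supp: "\<And>e. z e \<noteq> 0 \<Longrightarrow> e \<in> edges (Omega r d a)"
    and cyc: "\<And>B. B \<subseteq> {1..r * d} \<Longrightarrow> Suc (card B) = r \<Longrightarrow> bdry {1..r * d} z B = 0"
  shows "z e = 0"
proof (rule ccontr)
  assume "z e \<noteq> 0"
  define S where "S = S_block r a"
  define V where "V = {1..r * d}"
  define lo where "lo = r * a - (r - 1)"
  obtain e where e: "z e \<noteq> 0" and min: "\<And>e'. z e' \<noteq> 0 \<Longrightarrow> card (e \<inter> S) \<le> card (e' \<inter> S)"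
    using ex_has_least_nat[of "\<lambda>e. z e \<noteq> 0" e "\<lambda>e. card (e \<inter> S)"] \<open>z e \<noteq> 0\<close> by blast
  have eV: "e \<subseteq> V" "card e = r" using supp[OF e] by (simp_all add: Omega_def V_def)
  have finV: "finite V" by (simp add: V_def)
  have SV: "S \<subseteq> V" unfolding S_def V_def using r a by (rule S_block_subset)
  have fin: "finite e" "finite S" using finite_subset[OF eV(1) finV] finite_subset[OF SV finV] .
  \<comment> \<open>\<open>W\<close> stays fixed while \<open>T\<close> is replaced by other subsets
    of the block; \<open>p\<close> determines both the start of the window and a common
    sign.\<close>
  define W where "W = e - S"
  define T where "T = e \<inter> S"
  define p where "p = card {y\<in>W. y < lo}"
  have OS: "W \<inter> S = {}" "W \<subseteq> V" "finite W" using eV fin by (auto simp: W_def)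
  have eq: "W \<union> T = e" by (auto simp: W_def T_def)
  have Slo: "lo \<le> y" if "y \<in> S" for y using that by (simp add: S_def S_block_def lo_def)
  have inter: "(W \<union> U) \<inter> S = U" if "U \<subseteq> S" for U using that OS(1) by blast
  \<comment> \<open>Values pass to the complex numbers, where all roots of unity exist. The shift
    \<open>\<Sum>W + (r - p)\<close> accounts for the fixed vertices and the start of the
    window.\<close>
  have "of_rat (z (W \<union> T)) = (0 :: complex)"
  proof (rule window_cycle_eq_0[OF r fin(2), where z = "\<lambda>U. of_rat (z (W \<union> U))" and T = T and m = "card T" and c = "\<Sum>W + (r - p)"])
    show "inj_on (\<lambda>x. x mod r) S" unfolding S_def by (rule inj_on_mod_S_block)
    show "T \<subseteq> S" "card T = card T" by (simp_all add: T_def)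
    fix U assume U: "U \<subseteq> S" "card U = card T" "of_rat (z (W \<union> U)) \<noteq> (0 :: complex)"
    have finU: "finite U" using U(1) fin(2) by (rule finite_subset)
    have "z (W \<union> U) \<noteq> 0" using U(3) by auto
    from Omega_edge_window[OF r supp[OF this]]
    have "(\<Sum>(W \<union> U) + (r - card {y \<in> W \<union> U. y < lo})) mod r < card U"
      unfolding lo_def[symmetric] S_def[symmetric] inter[OF U(1)] .
    moreover have "{y \<in> W \<union> U. y < lo} = {y \<in> W. y < lo}"
      using Slo U(1) by (auto simp: not_less[symmetric])
    moreover have "\<Sum>(W \<union> U) = \<Sum>W + \<Sum>U"
      using OS U(1) finU by (intro sum.union_disjoint) auto
    ultimately show "(\<Sum>U + (\<Sum>W + (r - p))) mod r < card T"
      unfolding p_def U(2) by (simp only: ac_simps)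
  next
    fix B assume B: "B \<subseteq> S" "Suc (card B) = card T"
    have finB: "finite B" using B(1) fin(2) by (rule finite_subset)
    have "card (W \<union> B) = card W + card B"
      using OS B(1) finB by (intro card_Un_disjoint) auto
    moreover have "card e = card W + card T"
      unfolding eq[symmetric] using OS fin by (intro card_Un_disjoint) (auto simp: T_def)
    ultimately have "Suc (card (W \<union> B)) = r" using B(2) eV(2) by linarith
    then have "0 = bdry V z (W \<union> B)"
      using cyc[of "W \<union> B"] OS(2) B(1) SV by (simp add: V_def)
    also have "\<dots> = (\<Sum>v\<in>S - B. face_sign (W \<union> B) v * z (insert v (W \<union> B)))"
      unfolding bdry_def
    proof (rule sum.mono_neutral_right)
      show "S - B \<subseteq> V - (W \<union> B)" using SV OS(1) by blast
      show "\<forall>v\<in>V - (W \<union> B) - (S - B). face_sign (W \<union> B) v * z (insert v (W \<union> B)) = 0"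
      proof
        fix v assume "v \<in> V - (W \<union> B) - (S - B)"
        then have "insert v (W \<union> B) \<inter> S = B" using B(1) OS(1) by blast
        then have "z (insert v (W \<union> B)) = 0"
          using min[of "insert v (W \<union> B)"] B(2) unfolding T_def by fastforce
        then show "face_sign (W \<union> B) v * z (insert v (W \<union> B)) = 0" by simp
      qed
    qed (use finV in simp)
    also have "\<dots> = (\<Sum>v\<in>S - B. (-1) ^ p * (face_sign B v * z (W \<union> insert v B)))"
    proof (intro sum.cong refl)
      fix v assume v: "v \<in> S - B"
      have "{y \<in> W \<union> B. y < v} = {y\<in>W. y < lo} \<union> {y\<in>B. y < v}"
      proof -
        \<comment> \<open>A vertex outside the block lies on the same side of all block vertices, so
          the fixed vertices contribute the same sign \<open>(-1) ^ p\<close> for every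
          \<open>v\<close>.\<close>
        have "y < v \<longleftrightarrow> y < lo" if "y \<in> W" for y
        proof -
          have "y \<notin> S" using that OS(1) by blast
          moreover have "v \<in> S" using v by blast
          ultimately show ?thesis unfolding S_def S_block_def lo_def by auto
        qed
        then show ?thesis by auto
      qed
      moreover have "card ({y\<in>W. y < lo} \<union> {y\<in>B. y < v}) = p + card {y\<in>B. y < v}"
        unfolding p_def using OS B(1) finB by (intro card_Un_disjoint) auto
      ultimately have "face_sign (W \<union> B) v = (-1) ^ p * (face_sign B v :: rat)"
        unfolding face_sign_def by (simp only: power_add)
      then show "face_sign (W \<union> B) v * z (insert v (W \<union> B)) = (-1) ^ p * (face_sign B v * z (W \<union> insert v B))"
        by (simp only: Un_insert_right mult.assoc)
    qed
    also have "\<dots> = (-1) ^ p * (\<Sum>v\<in>S - B. face_sign B v * z (W \<union> insert v B))"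
      unfolding sum_distrib_left ..
    finally have "(\<Sum>v\<in>S - B. face_sign B v * z (W \<union> insert v B)) = 0" by simp
    then have "of_rat (\<Sum>v\<in>S - B. face_sign B v * z (W \<union> insert v B)) = (0 :: complex)"
      by (simp only: of_rat_0)
    then show "bdry S (\<lambda>U. of_rat (z (W \<union> U)) :: complex) B = 0"
      unfolding bdry_def of_rat_sum of_rat_mult of_rat_face_sign .
  qed
  then show False using e unfolding eq by simp
qed

section \<open>Comparison of \<open>bdry\<close> with \<open>boundary_coeff\<close>\<close>

lemma bdry_diff: "bdry V (\<lambda>A. f A - g A) B = bdry V f B - bdry V g B"
  by (simp only: bdry_def right_diff_distrib sum_subtractf)

lemma boundary_coeff_eq_sum_vertices:
  assumes "finite A"
  shows "boundary_coeff A B = (\<Sum>u\<in>A. if B = A - {u} then face_sign B u else 0)"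
proof -
  have "boundary_coeff A B
      = (\<Sum>j\<in>{1..card A}. if B = A - {vertex_at A j} then face_sign B (vertex_at A j) else 0)"
    unfolding boundary_coeff_def
  proof (intro sum.cong refl)
    fix j assume j: "j \<in> {1..card A}"
    have "{y \<in> A - {vertex_at A j}. y < vertex_at A j} = {y \<in> A. y < vertex_at A j}" by auto
    then have "face_sign (A - {vertex_at A j}) (vertex_at A j) = ((-1) ^ (j - 1) :: rat)"
      unfolding face_sign_def using card_less_vertex_at[OF assms, of j] j by simp
    then show "(if B = A - {vertex_at A j} then (- 1) ^ (j - 1) else 0)
        = (if B = A - {vertex_at A j} then face_sign B (vertex_at A j) else (0::rat))"
      by (auto split: if_split)
  qed
  also have "\<dots> = (\<Sum>u\<in>A. if B = A - {u} then face_sign B u else 0)"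
    by (rule sum.reindex_bij_betw[OF bij_betw_vertex_at[OF assms]])
  finally show ?thesis .
qed

text \<open>Reads the incidence matrix from the side of the face: removing \<open>u\<close> from
  \<open>A\<close> leaves \<open>B\<close> precisely when \<open>u\<close> is a vertex outside
  \<open>B\<close> whose addition gives \<open>A\<close>.\<close>

lemma boundary_coeff_eq_sum_cofaces:
  assumes "finite V" "A \<subseteq> V"
  shows "boundary_coeff A B = (\<Sum>v\<in>V - B. if A = insert v B then face_sign B v else 0)"
proof -
  have finA: "finite A" using assms(2,1) by (rule finite_subset)
  have "{u\<in>A. B = A - {u}} = {v\<in>V - B. A = insert v B}"
    using assms(2) by blast
  moreover have "boundary_coeff A B = (\<Sum>u\<in>{u\<in>A. B = A - {u}}. face_sign B u)"
    unfolding boundary_coeff_eq_sum_vertices[OF finA] sum.inter_filter[OF finA] ..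
  moreover have "finite (V - B)" using assms(1) by simp
  ultimately show ?thesis
    unfolding sum.inter_filter[OF \<open>finite (V - B)\<close>, symmetric] by (simp only:)
qed

text \<open>The bridge from the matrix form of the boundary to \<open>bdry\<close>, on which all
  earlier results are stated; a chain on \<open>Y\<close> becomes a function that is 0 off
  \<open>Y\<close>.\<close>

lemma sum_boundary_coeff:
  assumes "finite V" "finite Y" "Y \<subseteq> Pow V"
  shows "(\<Sum>A\<in>Y. c A * boundary_coeff A B) = bdry V (\<lambda>A. if A \<in> Y then c A else 0) B"
proof -
  have "(\<Sum>A\<in>Y. c A * boundary_coeff A B)
      = (\<Sum>A\<in>Y. \<Sum>v\<in>V - B. c A * (if A = insert v B then face_sign B v else 0))"
  proof (rule sum.cong[OF refl])
    fix A assume "A \<in> Y"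
    with assms(3) have "A \<subseteq> V" by blast
    from boundary_coeff_eq_sum_cofaces[OF assms(1) this, of B]
    show "c A * boundary_coeff A B
        = (\<Sum>v\<in>V - B. c A * (if A = insert v B then face_sign B v else 0))"
      by (simp only: sum_distrib_left)
  qed
  also have "\<dots> = (\<Sum>v\<in>V - B. \<Sum>A\<in>Y. c A * (if A = insert v B then face_sign B v else 0))"
    by (rule sum.swap)
  also have "\<dots> = (\<Sum>v\<in>V - B. face_sign B v * (if insert v B \<in> Y then c (insert v B) else 0))"
  proof (rule sum.cong[OF refl])
    fix v
    have "(\<Sum>A\<in>Y. c A * (if A = insert v B then face_sign B v else 0))
        = (\<Sum>A\<in>Y. if insert v B = A then c A * face_sign B v else 0)"
      by (rule sum.cong[OF refl]) auto
    also have "\<dots> = (if insert v B \<in> Y then c (insert v B) * face_sign B v else 0)"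
      by (rule sum.delta'[OF assms(2)])
    finally show "(\<Sum>A\<in>Y. c A * (if A = insert v B then face_sign B v else 0))
        = face_sign B v * (if insert v B \<in> Y then c (insert v B) else 0)"
      by (simp split: if_split)
  qed
  finally show ?thesis unfolding bdry_def .
qed

section \<open>The partition of the complete hypergraph\<close>

lemma mem_S_block_iff:
  assumes "r \<ge> 1" "a \<ge> 1" "v \<ge> 1"
  shows "v \<in> S_block r a \<longleftrightarrow> a = (v - 1) div r + 1"
proof -
  obtain b w where bw: "a = Suc b" "v = Suc w"
    using assms(2,3) by (metis Suc_le_D One_nat_def)
  have "v \<in> S_block r a \<longleftrightarrow> r * b \<le> w \<and> w < r * b + r"
    using assms(1) unfolding S_block_def bw by auto
  also have "\<dots> \<longleftrightarrow> w div r = b"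
    using assms(1) less_eq_div_iff_mult_less_eq[of r b w] div_less_iff_less_mult[of r w "Suc b"]
    by (auto simp: mult.commute)
  finally show ?thesis unfolding bw by auto
qed

text \<open>The congruence leaves a single \<open>t\<close>, and the vertex at that position lies in
  a single block. Disjointness and covering both follow.\<close>

lemma mem_edges_Omega_iff:
  assumes r: "r \<ge> 1" and e: "e \<subseteq> {1..r * d}" "card e = r" and a: "a \<ge> 1"
  shows "e \<in> edges (Omega r d a) \<longleftrightarrow> a = (vertex_at e (\<Sum>e mod r + 1) - 1) div r + 1"
proof -
  have fin: "finite e" using e(1) finite_subset by blast
  have lt: "\<Sum>e mod r < r" using r by simp
  have "vertex_at e (\<Sum>e mod r + 1) \<in> e"
    using lt e(2) by (intro vertex_at_mem[OF fin]) simp_all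
  then have v: "vertex_at e (\<Sum>e mod r + 1) \<ge> 1" using e(1) by auto
  have t: "[\<Sum>e = t - 1] (mod r) \<longleftrightarrow> t = \<Sum>e mod r + 1" if "t \<in> {1..r}" for t
  proof -
    have "t - 1 < r" "1 \<le> t" using that by auto
    then show ?thesis unfolding cong_def by auto
  qed
  have "e \<in> edges (Omega r d a) \<longleftrightarrow> (\<exists>t\<in>{1..r}. t = \<Sum>e mod r + 1 \<and> vertex_at e t \<in> S_block r a)"
    unfolding Omega_def using e t by auto
  also have "\<dots> \<longleftrightarrow> vertex_at e (\<Sum>e mod r + 1) \<in> S_block r a"
    using lt by auto
  finally show ?thesis unfolding mem_S_block_iff[OF r a v] .
qed

lemma edges_Omega_subset: "edges (Omega r d a) \<subseteq> edges (complete_hypergraph r (r * d))"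
  by (auto simp: Omega_def complete_hypergraph_def)

lemma finite_edges_Omega: "finite (edges (Omega r d a))"
  by (rule finite_subset[of _ "Pow {1..r * d}"]) (auto simp: Omega_def)

lemma edges_Omega_disjoint:
  assumes "r \<ge> 1" "a \<ge> 1" "b \<ge> 1" "a \<noteq> b"
  shows "edges (Omega r d a) \<inter> edges (Omega r d b) = {}"
proof -
  have False if "e \<in> edges (Omega r d a)" "e \<in> edges (Omega r d b)" for e
  proof -
    have e: "e \<subseteq> {1..r * d}" "card e = r"
      using that(1) by (simp_all add: Omega_def)
    show False
      using that mem_edges_Omega_iff[OF assms(1) e assms(2)] mem_edges_Omega_iff[OF assms(1) e assms(3)] assms(4)
      by simp
  qed
  then show ?thesis by blast
qed

lemma Union_edges_Omega:
  assumes r: "r \<ge> 1"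
  shows "(\<Union>a\<in>{1..d}. edges (Omega r d a)) = edges (complete_hypergraph r (r * d))"
proof (rule equalityI)
  show "(\<Union>a\<in>{1..d}. edges (Omega r d a)) \<subseteq> edges (complete_hypergraph r (r * d))"
    using edges_Omega_subset by blast
  show "edges (complete_hypergraph r (r * d)) \<subseteq> (\<Union>a\<in>{1..d}. edges (Omega r d a))"
  proof
    fix e assume "e \<in> edges (complete_hypergraph r (r * d))"
    then have e: "e \<subseteq> {1..r * d}" "card e = r" by (simp_all add: complete_hypergraph_def)
    have fin: "finite e" using e(1) finite_subset by blast
    define v where "v = vertex_at e (\<Sum>e mod r + 1)"
    have "\<Sum>e mod r < r" using r by simp
    then have "v \<in> e"
      unfolding v_def using e(2) by (intro vertex_at_mem[OF fin]) simp_all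
    with e(1) have v: "1 \<le> v" "v \<le> r * d" by auto
    define a where "a = (v - 1) div r + 1"
    have "(v - 1) div r < d"
      using r v div_less_iff_less_mult[of r "v - 1" d] by (simp add: mult.commute)
    then have a: "1 \<le> a" "a \<le> d" by (simp_all add: a_def)
    have "e \<in> edges (Omega r d a)"
      unfolding mem_edges_Omega_iff[OF r e a(1)] by (simp add: a_def v_def)
    with a show "e \<in> (\<Union>a\<in>{1..d}. edges (Omega r d a))" by auto
  qed
qed

section \<open>Counting hyperedges and filling cycles\<close>

text \<open>Only ridges avoiding vertex 1 serve as equations, because their number is the desired
  edge count. A boundary is a cycle, so vanishing on them makes it vanish on all ridges, and the
  chain is itself a top cycle.\<close>

lemma Omega_boundary_injective:
  fixes c :: "nat set \<Rightarrow> rat"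
  assumes r: "r \<ge> 1" and a: "1 \<le> a" "a \<le> d"
    and c: "\<And>B. B \<subseteq> {2..r * d} \<Longrightarrow> card B = r - 1 \<Longrightarrow>
      (\<Sum>e\<in>edges (Omega r d a). c e * boundary_coeff e B) = 0"
    and e: "e \<in> edges (Omega r d a)"
  shows "c e = 0"
proof -
  define V where "V = {1..r * d}"
  define Y where "Y = edges (Omega r d a)"
  define f where "f A = (if A \<in> Y then c A else 0)" for A
  have V: "finite V" by (simp add: V_def)
  have "1 * 1 \<le> r * d" using r a by (intro mult_le_mono) simp_all
  then have 1: "1 \<in> V" by (simp add: V_def)
  have Y: "finite Y" "Y \<subseteq> Pow V" unfolding Y_def V_def
    by (rule finite_edges_Omega) (auto simp: Omega_def)
  have bd0: "bdry V f B = 0" if "B \<subseteq> V" "card B = r - 1" for B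
  proof (rule cycle_eq_0I[OF V 1 _ _ _ that])
    show "1 \<le> v" if "v \<in> V" for v using that by (simp add: V_def)
    show "bdry V (bdry V f) B = 0" if "B \<subseteq> V" for B
      by (rule bdry_bdry[OF V finite_subset[OF that V]])
    fix B assume B: "B \<subseteq> V" "card B = r - 1" "1 \<notin> B"
    have "B \<subseteq> {2..r * d}"
    proof
      fix v assume "v \<in> B"
      then have "v \<in> V" "v \<noteq> 1" using B by auto
      then show "v \<in> {2..r * d}" by (simp add: V_def)
    qed
    from c[OF this B(2)] show "bdry V f B = 0"
      unfolding Y_def[symmetric] sum_boundary_coeff[OF V Y] f_def .
  qed
  have "f e = 0"
  proof (rule Omega_top_cycle_eq_0[OF r a])
    show "e \<in> edges (Omega r d a)" if "f e \<noteq> 0" for e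
      using that unfolding f_def Y_def by meson
    show "bdry {1..r * d} f B = 0" if "B \<subseteq> {1..r * d}" "Suc (card B) = r" for B
      using bd0[of B] that by (simp add: V_def)
  qed
  with e show ?thesis by (simp add: f_def Y_def)
qed

lemma card_subsets_avoiding_first: "card {B. B \<subseteq> {2..n} \<and> card B = k} = (n - 1) choose k"
  by (subst n_subsets) simp_all

lemma card_edges_Omega:
  assumes r: "r \<ge> 1" and a: "1 \<le> a" "a \<le> d"
  shows "card (edges (Omega r d a)) = (r * d - 1) choose (r - 1)"
proof -
  let ?X = "{B. B \<subseteq> {2..r * d} \<and> card B = r - 1}"
  have finX: "finite ?X" by simp
  have le: "card (edges (Omega r d b)) \<le> (r * d - 1) choose (r - 1)" if b: "b \<in> {1..d}" for b
    unfolding card_subsets_avoiding_first[symmetric]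
  proof (rule injective_system_card_le[OF finX finite_edges_Omega])
    fix c :: "nat set \<Rightarrow> rat" and e
    assume c: "\<And>B. B \<in> ?X \<Longrightarrow> (\<Sum>e\<in>edges (Omega r d b). c e * boundary_coeff e B) = 0"
      and e: "e \<in> edges (Omega r d b)"
    show "c e = 0"
    proof (rule Omega_boundary_injective[OF r _ _ _ e])
      show "1 \<le> b" "b \<le> d" using b by simp_all
      show "(\<Sum>e\<in>edges (Omega r d b). c e * boundary_coeff e B) = 0"
        if "B \<subseteq> {2..r * d}" "card B = r - 1" for B
        using that by (intro c) simp
    qed
  qed
  have "(\<Sum>b\<in>{1..d}. card (edges (Omega r d b))) = card (\<Union>b\<in>{1..d}. edges (Omega r d b))"
    by (rule card_UN_disjoint[symmetric]) (simp_all add: finite_edges_Omega edges_Omega_disjoint[OF r])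
  also have "\<dots> = (r * d) choose r"
    unfolding Union_edges_Omega[OF r] complete_hypergraph_def by (simp add: n_subsets)
  \<comment> \<open>The absorption identity for binomial coefficients, with the factor
    \<open>r\<close> cancelled.\<close>
  also have "\<dots> = d * ((r * d - 1) choose (r - 1))"
  proof -
    have "1 * 1 \<le> r * d" using r a by (intro mult_le_mono) simp_all
    then have "Suc (r * d - 1) = r * d" "Suc (r - 1) = r" using r by simp_all
    then have "r * ((r * d) choose r) = (r * d) * ((r * d - 1) choose (r - 1))"
      using Suc_times_binomial[of "r - 1" "r * d - 1"] by simp
    then show ?thesis using r by simp
  qed
  also have "\<dots> = (\<Sum>b\<in>{1..d}. (r * d - 1) choose (r - 1))" by simp
  finally have sum: "(\<Sum>b\<in>{1..d}. card (edges (Omega r d b))) = (\<Sum>b\<in>{1..d}. (r * d - 1) choose (r - 1))" .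
  \<comment> \<open>Termwise inequalities between equal sums are equalities.\<close>
  show ?thesis
    by (rule sum_mono_inv[OF sum le]) (use a in simp_all)
qed

text \<open>By the edge count the system of ridges avoiding vertex 1 is square and injective, hence
  solvable. The boundary of the solution differs from \<open>z\<close> by a cycle that vanishes on
  those ridges, hence on all ridges.\<close>

lemma Omega_cycle_is_boundary:
  fixes z :: "nat set \<Rightarrow> rat"
  assumes r: "r \<ge> 1" and a: "1 \<le> a" "a \<le> d"
    and z: "\<And>B. B \<subseteq> {1..r * d} \<Longrightarrow> Suc (card B) = r - 1 \<Longrightarrow> bdry {1..r * d} z B = 0"
  shows "\<exists>c. \<forall>B. B \<subseteq> {1..r * d} \<longrightarrow> card B = r - 1 \<longrightarrow>
    bdry {1..r * d} (\<lambda>e. if e \<in> edges (Omega r d a) then c e else 0) B = z B"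
proof -
  define V where "V = {1..r * d}"
  define Y where "Y = edges (Omega r d a)"
  let ?X = "{B. B \<subseteq> {2..r * d} \<and> card B = r - 1}"
  have V: "finite V" by (simp add: V_def)
  have "1 * 1 \<le> r * d" using r a by (intro mult_le_mono) simp_all
  then have 1: "1 \<in> V" by (simp add: V_def)
  have Y: "finite Y" "Y \<subseteq> Pow V" unfolding Y_def V_def
    by (rule finite_edges_Omega) (auto simp: Omega_def)
  have "\<exists>c. \<forall>B\<in>?X. (\<Sum>e\<in>Y. c e * boundary_coeff e B) = z B"
  proof (rule injective_square_system_solvable[OF _ Y(1)])
    show "finite ?X" by simp
    show "card Y = card ?X"
      unfolding Y_def card_edges_Omega[OF r a] card_subsets_avoiding_first ..
    fix c :: "nat set \<Rightarrow> rat" and e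
    assume c: "\<And>B. B \<in> ?X \<Longrightarrow> (\<Sum>e\<in>Y. c e * boundary_coeff e B) = 0" and e: "e \<in> Y"
    show "c e = 0"
    proof (rule Omega_boundary_injective[OF r a _ e[unfolded Y_def]])
      show "(\<Sum>e\<in>edges (Omega r d a). c e * boundary_coeff e B) = 0"
        if "B \<subseteq> {2..r * d}" "card B = r - 1" for B
        unfolding Y_def[symmetric] using that by (intro c) simp
    qed
  qed
  then obtain c where c: "\<And>B. B \<in> ?X \<Longrightarrow> (\<Sum>e\<in>Y. c e * boundary_coeff e B) = z B" by blast
  define f where "f A = (if A \<in> Y then c A else 0)" for A
  define g where "g A = bdry V f A - z A" for A
  have "g B = 0" if B: "B \<subseteq> V" "card B = r - 1" for B
  proof (rule cycle_eq_0I[OF V 1 _ _ _ B])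
    show "1 \<le> v" if "v \<in> V" for v using that by (simp add: V_def)
    show "bdry V g B = 0" if "B \<subseteq> V" "Suc (card B) = r - 1" for B
    proof -
      have "bdry V (bdry V f) B = 0" by (rule bdry_bdry[OF V finite_subset[OF that(1) V]])
      moreover have "bdry V z B = 0" using z that unfolding V_def by blast
      ultimately show ?thesis unfolding g_def bdry_diff by simp
    qed
    fix B assume B: "B \<subseteq> V" "card B = r - 1" "1 \<notin> B"
    have "B \<subseteq> {2..r * d}"
    proof
      fix v assume "v \<in> B"
      then have "v \<in> V" "v \<noteq> 1" using B by auto
      then show "v \<in> {2..r * d}" by (simp add: V_def)
    qed
    with B(2) have "B \<in> ?X" by simp
    from c[OF this] show "g B = 0"
      unfolding sum_boundary_coeff[OF V Y] g_def f_def by simp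
  qed
  then have "\<forall>B. B \<subseteq> V \<longrightarrow> card B = r - 1 \<longrightarrow> bdry V f B = z B"
    unfolding g_def by simp
  then show ?thesis unfolding f_def V_def Y_def by blast
qed

section \<open>Faces of the hypergraphs\<close>

text \<open>The boundary of an \<open>r\<close>-set containing \<open>B\<close> is a cycle that is
  nonzero at \<open>B\<close>. It is also the boundary of a chain of edges, which would be 0 at
  \<open>B\<close> if no edge contained \<open>B\<close>.\<close>

lemma Omega_covers_ridges:
  assumes r: "r \<ge> 1" and a: "1 \<le> a" "a \<le> d" and B: "B \<subseteq> {1..r * d}" "card B = r - 1"
  shows "\<exists>e\<in>edges (Omega r d a). B \<subseteq> e"
proof -
  define V where "V = {1..r * d}"
  have V: "finite V" by (simp add: V_def)
  have BV: "B \<subseteq> V" using B(1) by (simp add: V_def)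
  have "r * 1 \<le> r * d" using a by (intro mult_le_mono2) simp
  then have "card B < r * d" unfolding B(2) using r by linarith
  then have "card B < card V" by (simp add: V_def)
  then have "B \<noteq> V" by blast
  with BV obtain v where v: "v \<in> V" "v \<notin> B" by blast
  define \<delta> :: "nat set \<Rightarrow> rat" where "\<delta> A = (if A = insert v B then 1 else 0)" for A
  have "bdry V (bdry V \<delta>) C = 0" if "C \<subseteq> V" for C
    by (rule bdry_bdry[OF V finite_subset[OF that V]])
  then obtain c where c: "\<And>C. C \<subseteq> V \<Longrightarrow> card C = r - 1 \<Longrightarrow>
      bdry V (\<lambda>e. if e \<in> edges (Omega r d a) then c e else 0) C = bdry V \<delta> C"
    using Omega_cycle_is_boundary[OF r a, of "bdry V \<delta>"] unfolding V_def by blast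
  have "bdry V \<delta> B = (\<Sum>w\<in>{v}. face_sign B w * \<delta> (insert w B))"
    unfolding bdry_def
  proof (rule sum.mono_neutral_right)
    show "\<forall>w\<in>V - B - {v}. face_sign B w * \<delta> (insert w B) = 0"
    proof
      fix w assume "w \<in> V - B - {v}"
      then have "insert w B \<noteq> insert v B" using v by blast
      then show "face_sign B w * \<delta> (insert w B) = 0" by (simp add: \<delta>_def)
    qed
  qed (use V v in simp_all)
  also have "\<dots> = face_sign B v" by (simp add: \<delta>_def)
  finally have "bdry V \<delta> B \<noteq> 0" by (simp add: face_sign_def)
  moreover have "bdry V \<delta> B = 0" if none: "\<And>w. insert w B \<notin> edges (Omega r d a)"
  proof -
    have "bdry V (\<lambda>e. if e \<in> edges (Omega r d a) then c e else 0) B = 0"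
      unfolding bdry_def by (simp only: none if_False mult_zero_right sum.neutral_const)
    with c[OF BV B(2)] show ?thesis by (simp only:)
  qed
  ultimately obtain w where "insert w B \<in> edges (Omega r d a)" by blast
  then show ?thesis by blast
qed

text \<open>Enlarging a set to a ridge reduces this to \<open>Omega_covers_ridges\<close>.\<close>

lemma E_sub_Omega:
  assumes r: "r \<ge> 1" and a: "1 \<le> a" "a \<le> d" and s: "s < r"
  shows "E_sub (Omega r d a) s = {A. A \<subseteq> {1..r * d} \<and> card A = s}"
proof (intro equalityI subsetI)
  fix A assume "A \<in> E_sub (Omega r d a) s"
  then show "A \<in> {A. A \<subseteq> {1..r * d} \<and> card A = s}"
    by (simp add: E_sub_def Omega_def)
next
  fix A assume "A \<in> {A. A \<subseteq> {1..r * d} \<and> card A = s}"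
  then have A: "A \<subseteq> {1..r * d}" "card A = s" by simp_all
  have "r * 1 \<le> r * d" using a by (intro mult_le_mono2) simp
  then have "r - 1 \<le> r * d" by linarith
  then have "r - 1 \<le> card {1..r * d}" by simp
  moreover have "card A \<le> r - 1" using A(2) s by linarith
  ultimately obtain B where B: "A \<subseteq> B" "B \<subseteq> {1..r * d}" "card B = r - 1"
    using exists_subset_between[of A "r - 1" "{1..r * d}"] A(1) finite_atLeastAtMost by blast
  obtain e where "e \<in> edges (Omega r d a)" "B \<subseteq> e"
    using Omega_covers_ridges[OF r a B(2,3)] by blast
  moreover from this B(1) have "A \<subseteq> e" by simp
  moreover have "A \<subseteq> verts (Omega r d a)" using A(1) by (simp add: Omega_def)
  moreover have "finite A" using A(1) by (rule finite_subset) simp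
  ultimately show "A \<in> E_sub (Omega r d a) s"
    using A(2) unfolding E_sub_def by blast
qed

lemma E_sub_Omega_top: "r \<ge> 1 \<Longrightarrow> E_sub (Omega r d a) r = edges (Omega r d a)"
proof (intro equalityI subsetI)
  fix A assume "A \<in> E_sub (Omega r d a) r" and r: "r \<ge> 1"
  then obtain e where A: "finite A" "card A = r" "A \<subseteq> e" and e: "e \<in> edges (Omega r d a)"
    unfolding E_sub_def by blast
  have "card e = r" using e by (simp add: Omega_def)
  moreover have "finite e" using \<open>card e = r\<close> r by (intro card_ge_0_finite) simp
  ultimately have "A = e" using A by (intro card_subset_eq) simp_all
  with e show "A \<in> edges (Omega r d a)" by simp
next
  fix A assume A: "A \<in> edges (Omega r d a)"
  then have "A \<subseteq> verts (Omega r d a)" "card A = r" by (simp_all add: Omega_def)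
  moreover from this(1) have "finite A" by (rule finite_subset) (simp add: Omega_def)
  ultimately show "A \<in> E_sub (Omega r d a) r"
    using A unfolding E_sub_def by blast
qed

lemma E_sub_Omega_above: "s > r \<Longrightarrow> r \<ge> 1 \<Longrightarrow> E_sub (Omega r d a) s = {}"
proof -
  assume s: "s > r" and r: "r \<ge> 1"
  have False if A: "card A = s" "A \<subseteq> e" and e: "e \<in> edges (Omega r d a)" for A e
  proof -
    have "card e = r" using e by (simp add: Omega_def)
    moreover have "finite e" using \<open>card e = r\<close> r by (intro card_ge_0_finite) simp
    ultimately show False using card_mono[OF _ A(2)] A(1) s by simp
  qed
  then show ?thesis unfolding E_sub_def by blast
qed

section \<open>Betti numbers\<close>

lemma dim_trivial:
  assumes "vectorspace K V" "carrier V = {\<zero>\<^bsub>V\<^esub>}"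
  shows "vectorspace.dim K V = 0"
proof -
  interpret vectorspace K V by (rule assms(1))
  have "span {} = carrier V"
    unfolding span_def assms(2) by (auto simp: lincomb_def)
  then show ?thesis
    unfolding dim_def by (intro Least_eq_0 exI[of _ "{}"]) simp
qed

text \<open>All cosets coincide with the carrier, so the quotient is the zero space.\<close>

lemma dim_quotient_self:
  assumes "vectorspace K M"
  shows "vectorspace.dim K (quotient_module M (carrier M)) = 0"
proof -
  interpret vectorspace K M by (rule assms)
  let ?Q = "quotient_module M (carrier M)"
  have coset: "carrier M +>\<^bsub>M\<^esub> x = carrier M" if x: "x \<in> carrier M" for x
  proof (intro equalityI subsetI)
    fix y assume "y \<in> carrier M +>\<^bsub>M\<^esub> x"
    then show "y \<in> carrier M" using x unfolding a_r_coset_def' by auto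
  next
    fix y assume y: "y \<in> carrier M"
    have "y = (y \<ominus>\<^bsub>M\<^esub> x) \<oplus>\<^bsub>M\<^esub> x"
      using x y by (simp add: M.minus_eq M.a_assoc M.l_neg)
    moreover have "y \<ominus>\<^bsub>M\<^esub> x \<in> carrier M" using x y by simp
    ultimately show "y \<in> carrier M +>\<^bsub>M\<^esub> x" unfolding a_r_coset_def' by blast
  qed
  have ne: "carrier M \<noteq> {}" using M.zero_closed by blast
  have car: "carrier ?Q = {carrier M}"
    unfolding quotient_module_def A_RCOSETS_def' using coset ne by auto
  have zero: "\<zero>\<^bsub>?Q\<^esub> = carrier M"
    by (simp add: quotient_module_def)
  have add: "carrier M \<oplus>\<^bsub>?Q\<^esub> carrier M = carrier M"
  proof -
    have "carrier M <+>\<^bsub>M\<^esub> carrier M = (\<Union>k\<in>carrier M. carrier M +>\<^bsub>M\<^esub> k)"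
      unfolding set_add_def' a_r_coset_def' by blast
    also have "\<dots> = carrier M" using coset ne by simp
    finally show ?thesis by (simp add: quotient_module_def)
  qed
  have smult: "c \<odot>\<^bsub>?Q\<^esub> carrier M = carrier M" if "c \<in> carrier K" for c
  proof -
    have "carrier M +>\<^bsub>M\<^esub> (c \<odot>\<^bsub>M\<^esub> x) = carrier M" if "x \<in> carrier M" for x
      using that \<open>c \<in> carrier K\<close> by (intro coset) simp
    then show ?thesis using ne by (simp add: quotient_module_def)
  qed
  have "vectorspace K ?Q"
    by (rule vs_criteria) (use field_axioms in \<open>simp_all add: car zero add smult\<close>)
  then show ?thesis
    by (rule dim_trivial) (simp add: car zero)
qed

section \<open>Chain spaces and a criterion for vanishing homology\<close>

lemma chain_space_simps:
  "carrier (chain_space H p) = simplices H p \<rightarrow>\<^sub>E UNIV"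
  "\<zero>\<^bsub>chain_space H p\<^esub> = (\<lambda>v\<in>simplices H p. 0)"
  "f \<oplus>\<^bsub>chain_space H p\<^esub> g = (\<lambda>v\<in>simplices H p. f v + g v)"
  "c \<odot>\<^bsub>chain_space H p\<^esub> f = (\<lambda>v\<in>simplices H p. c * f v)"
  unfolding chain_space_def ring.func_space_def[OF class_ring.ring_axioms] by simp_all

lemma module_chain_space: "module class_ring (chain_space H p)"
  unfolding chain_space_def by (rule cring.func_space_is_module[OF class_cring.cring_axioms])

lemma field_class_ring: "field (class_ring :: 'a::field ring)"
  by (rule class_field.field_axioms)

lemma mod_hom_boundary:
  "mod_hom class_ring (chain_space H p) (chain_space H (p - 1)) (boundary H p)"
proof (intro mod_hom.intro module_chain_space mod_hom_axioms.intro)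
  show "boundary H p \<in> LinearCombinations.module_hom class_ring (chain_space H p) (chain_space H (p - 1))"
    unfolding LinearCombinations.module_hom_def
  proof (intro CollectI conjI allI impI)
    show "boundary H p \<in> carrier (chain_space H p) \<rightarrow> carrier (chain_space H (p - 1))"
      unfolding chain_space_simps boundary_def by (intro Pi_I restrict_PiE_iff[THEN iffD2] ballI UNIV_I)
    fix f g
    show "boundary H p (f \<oplus>\<^bsub>chain_space H p\<^esub> g)
        = boundary H p f \<oplus>\<^bsub>chain_space H (p - 1)\<^esub> boundary H p g"
      unfolding chain_space_simps boundary_def
      by (intro restrict_ext) (simp add: distrib_right sum.distrib)
  next
    fix c f
    show "boundary H p (c \<odot>\<^bsub>chain_space H p\<^esub> f) = c \<odot>\<^bsub>chain_space H (p - 1)\<^esub> boundary H p f"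
      unfolding chain_space_simps boundary_def
      by (intro restrict_ext) (simp add: sum_distrib_left mult.assoc)
  qed
qed

lemma betti_eq_0:
  assumes "cycles H p = boundaries H p"
  shows "betti H p = 0"
proof -
  interpret mod_hom class_ring "chain_space H p" "chain_space H (p - 1)" "boundary H p"
    by (rule mod_hom_boundary)
  have "submodule class_ring (cycles H p) (chain_space H p)"
    unfolding cycles_def by (rule ker_is_submodule)
  then have "module class_ring ((chain_space H p)\<lparr>carrier := cycles H p\<rparr>)"
    by (rule M.submodule_is_module)
  then have "vectorspace class_ring ((chain_space H p)\<lparr>carrier := cycles H p\<rparr>)"
    by (intro vectorspace.intro field_class_ring)
  from dim_quotient_self[OF this] show ?thesis
    unfolding betti_def homology_def assms[symmetric] by simp
qed

lemma boundary_apply: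
  assumes "finite V" "simplices H p \<subseteq> Pow V" "B \<in> simplices H (p - 1)"
  shows "boundary H p c B = bdry V (\<lambda>A. if A \<in> simplices H p then c A else 0) B"
proof -
  have "finite (simplices H p)" using assms(1,2) by (meson finite_Pow_iff finite_subset)
  from sum_boundary_coeff[OF assms(1) this assms(2)] show ?thesis
    unfolding boundary_def using assms(3) by (simp only: restrict_apply if_True)
qed

text \<open>Trades extensional chains, undefined off the basis, for functions that are 0 there.
  Assumption \<open>bdbd\<close> puts the boundaries among the cycles, and \<open>exact\<close>
  gives the converse.\<close>

lemma betti_eq_0I:
  assumes V: "finite V" and p: "simplices H p \<subseteq> Pow V" "simplices H (p + 1) \<subseteq> Pow V"
    and bdbd: "\<And>(f :: nat set \<Rightarrow> rat) B. (\<And>A. A \<notin> simplices H (p + 1) \<Longrightarrow> f A = 0) \<Longrightarrow> B \<in> simplices H (p - 1) \<Longrightarrow>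
      bdry V (\<lambda>A. if A \<in> simplices H p then bdry V f A else 0) B = 0"
    and exact: "\<And>f :: nat set \<Rightarrow> rat. (\<And>A. A \<notin> simplices H p \<Longrightarrow> f A = 0) \<Longrightarrow>
      (\<And>B. B \<in> simplices H (p - 1) \<Longrightarrow> bdry V f B = 0) \<Longrightarrow>
      \<exists>g. (\<forall>A. A \<notin> simplices H (p + 1) \<longrightarrow> g A = 0) \<and> (\<forall>A\<in>simplices H p. bdry V g A = f A)"
  shows "betti H p = 0"
proof (rule betti_eq_0)
  have "mod_hom class_ring (chain_space H (p + 1)) (chain_space H p) (boundary H (p + 1))"
    using mod_hom_boundary[of H "p + 1"] by simp
  then have bs: "boundaries H p = boundary H (p + 1) ` carrier (chain_space H (p + 1))"
    unfolding boundaries_def by (rule mod_hom.im_def)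
  have cs: "cycles H p = {c \<in> carrier (chain_space H p). boundary H p c = \<zero>\<^bsub>chain_space H (p - 1)\<^esub>}"
    unfolding cycles_def by (rule mod_hom.ker_def[OF mod_hom_boundary])
  have bdry_up: "boundary H (p + 1) c A = bdry V (\<lambda>A. if A \<in> simplices H (p + 1) then c A else 0) A"
    if "A \<in> simplices H p" for c A
    using boundary_apply[OF V p(2), of A c] that by simp
  show "cycles H p = boundaries H p"
  proof (intro equalityI subsetI)
    fix c assume "c \<in> cycles H p"
    then have c: "c \<in> simplices H p \<rightarrow>\<^sub>E UNIV" "boundary H p c = (\<lambda>v\<in>simplices H (p - 1). 0)"
      unfolding cs chain_space_simps by simp_all
    define f where "f A = (if A \<in> simplices H p then c A else 0)" for A
    have "\<exists>g. (\<forall>A. A \<notin> simplices H (p + 1) \<longrightarrow> g A = 0) \<and> (\<forall>A\<in>simplices H p. bdry V g A = f A)"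
    proof (rule exact)
      show "f A = 0" if "A \<notin> simplices H p" for A using that by (simp add: f_def)
      show "bdry V f B = 0" if "B \<in> simplices H (p - 1)" for B
        using boundary_apply[OF V p(1) that, of c] that unfolding c(2) f_def by simp
    qed
    then obtain g where g: "\<And>A. A \<notin> simplices H (p + 1) \<Longrightarrow> g A = 0"
      "\<And>A. A \<in> simplices H p \<Longrightarrow> bdry V g A = f A" by blast
    \<comment> \<open>Restricting \<open>g\<close> to the basis and extending by 0 gives back
      \<open>g\<close>, so both descriptions have the same boundary.\<close>
    have ext: "(\<lambda>A. if A \<in> simplices H (p + 1) then restrict g (simplices H (p + 1)) A else 0) = g"
      using g(1) by (intro ext) simp
    have "boundary H (p + 1) (restrict g (simplices H (p + 1))) = c"
    proof (rule extensionalityI[where A = "simplices H p"])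
      show "boundary H (p + 1) (restrict g (simplices H (p + 1))) \<in> extensional (simplices H p)"
        unfolding boundary_def by simp
      show "c \<in> extensional (simplices H p)" using c(1) by (simp add: PiE_def)
      show "boundary H (p + 1) (restrict g (simplices H (p + 1))) A = c A" if "A \<in> simplices H p" for A
        unfolding bdry_up[OF that] ext g(2)[OF that] using that by (simp add: f_def)
    qed
    moreover have "restrict g (simplices H (p + 1)) \<in> carrier (chain_space H (p + 1))"
      unfolding chain_space_simps by simp
    ultimately show "c \<in> boundaries H p" unfolding bs by blast
  next
    fix c assume "c \<in> boundaries H p"
    then obtain g where c: "c = boundary H (p + 1) g" unfolding bs by blast
    define f where "f A = (if A \<in> simplices H (p + 1) then g A else 0)" for A
    have eq: "(\<lambda>A. if A \<in> simplices H p then c A else 0) = (\<lambda>A. if A \<in> simplices H p then bdry V f A else 0)"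
      unfolding c f_def using bdry_up[of _ g] by (intro ext) simp
    have "boundary H p c = (\<lambda>v\<in>simplices H (p - 1). 0)"
    proof (rule extensionalityI[where A = "simplices H (p - 1)"])
      show "boundary H p c \<in> extensional (simplices H (p - 1))" unfolding boundary_def by simp
      show "boundary H p c B = (\<lambda>v\<in>simplices H (p - 1). 0) B" if "B \<in> simplices H (p - 1)" for B
        unfolding boundary_apply[OF V p(1) that] eq using that bdbd[of f B] by (simp add: f_def)
    qed simp
    moreover have "c \<in> carrier (chain_space H p)"
      unfolding chain_space_simps c boundary_def by simp
    ultimately show "c \<in> cycles H p" unfolding cs chain_space_simps by simp
  qed
qed

section \<open>Acyclicity of the hypergraphs\<close>

lemma simplices_Omega:
  assumes r: "r \<ge> 1" and a: "1 \<le> a" "a \<le> d"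
  shows "simplices (Omega r d a) (int k - 1) =
    (if k < r then {A. A \<subseteq> {1..r * d} \<and> card A = k} else if k = r then edges (Omega r d a) else {})"
\<comment> \<open>Degree -1 is a separate clause of \<open>simplices\<close>; it fits the general
  formula because \<open>0 < r\<close>.\<close>
proof (cases "k = 0")
  case True
  have "A = {}" if "A \<subseteq> {1..r * d}" "card A = 0" for A
    using that finite_subset[OF that(1)] by simp
  then show ?thesis using True r by (auto simp: simplices_def)
next
  case False
  then have "simplices (Omega r d a) (int k - 1) = E_sub (Omega r d a) k"
    by (simp add: simplices_def)
  then show ?thesis
    using E_sub_Omega[OF r a, of k] E_sub_Omega_top[OF r, of d a] E_sub_Omega_above[OF _ r, of k d a]
    by simp
qed

text \<open>Three ranges of \<open>k\<close>: at the top injectivity, just below it the filling of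
  cycles by edges, and further down the cone over vertex 1.\<close>

lemma betti_Omega:
  assumes r: "r \<ge> 1" and a: "1 \<le> a" "a \<le> d" and k: "k \<le> r"
  shows "betti (Omega r d a) (int k - 1) = 0"
proof -
  define V where "V = {1..r * d}"
  define H where "H = Omega r d a"
  have V: "finite V" by (simp add: V_def)
  have "1 * 1 \<le> r * d" using r a by (intro mult_le_mono) simp_all
  then have 1: "1 \<in> V" by (simp add: V_def)
  have min: "1 \<le> v" if "v \<in> V" for v using that by (simp add: V_def)
  have edge: "A \<subseteq> V" "card A = r" if "A \<in> edges H" for A
    using that by (simp_all add: H_def V_def Omega_def)
  have s: "simplices H (int k - 1) =
      (if k < r then {A. A \<subseteq> V \<and> card A = k} else if k = r then edges H else {})" for k
    unfolding H_def V_def by (rule simplices_Omega[OF r a])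
  have sub: "simplices H (int k - 1) \<subseteq> Pow V" for k
    unfolding s using edge(1) by auto
  \<comment> \<open>For \<open>k = 0\<close> the degree is -2, where there are no simplices.\<close>
  have below: "B \<subseteq> V \<and> Suc (card B) = k" if "B \<in> simplices H (int k - 1 - 1)" for B
  proof (cases k)
    case 0
    then show ?thesis using that by (simp add: simplices_def)
  next
    case (Suc j)
    then have "B \<in> simplices H (int j - 1)" using that by simp
    then show ?thesis unfolding s using Suc k by simp
  qed
  have below': "B \<in> simplices H (int k - 1 - 1)" if "B \<subseteq> V" "Suc (card B) = k" for B
  proof -
    have eq: "int k - 1 - 1 = int (card B) - 1" using that(2) by linarith
    have "card B < r" using that(2) k by linarith
    then show ?thesis unfolding eq s using that(1) by simp
  qed
  have above: "simplices H (int k - 1 + 1) =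
      (if Suc k < r then {A. A \<subseteq> V \<and> card A = Suc k} else if Suc k = r then edges H else {})"
    using s[of "Suc k"] by simp
  have card_insert: "card (insert v B) = Suc (card B)" if "B \<subseteq> V" "v \<in> V - B" for v B
    using that finite_subset[OF that(1) V] by simp
  have "betti H (int k - 1) = 0"
  proof (rule betti_eq_0I[OF V sub])
    show "simplices H (int k - 1 + 1) \<subseteq> Pow V" using sub[of "Suc k"] by simp
  next
    fix f :: "nat set \<Rightarrow> rat" and B
    assume f: "\<And>A. A \<notin> simplices H (int k - 1 + 1) \<Longrightarrow> f A = 0" and B: "B \<in> simplices H (int k - 1 - 1)"
    have BV: "B \<subseteq> V" "Suc (card B) = k" using below[OF B] by simp_all
    have "bdry V (\<lambda>A. if A \<in> simplices H (int k - 1) then bdry V f A else 0) B = bdry V (bdry V f) B"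
    proof (rule bdry_cong)
      fix v assume v: "v \<in> V" "v \<notin> B"
      show "(if insert v B \<in> simplices H (int k - 1) then bdry V f (insert v B) else 0) = bdry V f (insert v B)"
      \<comment> \<open>Below the top degree the skeleton is full and the cutoff changes nothing; in
        the top degree there are no simplices above, so \<open>f\<close> is 0.\<close>
      proof (cases "k < r")
        case True
        have "insert v B \<in> simplices H (int k - 1)"
          unfolding s using True v BV card_insert[of B v] by simp
        then show ?thesis by simp
      next
        case False
        then have "simplices H (int k - 1 + 1) = {}" unfolding above by simp
        with f have "f A = 0" for A by simp
        then have "bdry V f (insert v B) = 0" unfolding bdry_def by simp
        then show ?thesis by simp
      qed
    qed
    also have "\<dots> = 0" by (rule bdry_bdry[OF V finite_subset[OF BV(1) V]])
    finally show "bdry V (\<lambda>A. if A \<in> simplices H (int k - 1) then bdry V f A else 0) B = 0" .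
  next
    fix f :: "nat set \<Rightarrow> rat"
    assume f: "\<And>A. A \<notin> simplices H (int k - 1) \<Longrightarrow> f A = 0"
      and cyc': "\<And>B. B \<in> simplices H (int k - 1 - 1) \<Longrightarrow> bdry V f B = 0"
    have cyc: "bdry V f B = 0" if "B \<subseteq> V" "Suc (card B) = k" for B
      by (rule cyc'[OF below'[OF that]])
    consider "k = r" | "Suc k = r" | "Suc k < r" using k by linarith
    then show "\<exists>g. (\<forall>A. A \<notin> simplices H (int k - 1 + 1) \<longrightarrow> g A = 0) \<and>
        (\<forall>A\<in>simplices H (int k - 1). bdry V g A = f A)"
    proof cases
      case 1
      have "f A = 0" for A
      proof (rule Omega_top_cycle_eq_0[OF r a])
        show "e \<in> edges (Omega r d a)" if "f e \<noteq> 0" for e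
          using f[of e] that 1 s[of k] unfolding H_def by auto
        show "bdry {1..r * d} f B = 0" if "B \<subseteq> {1..r * d}" "Suc (card B) = r" for B
          using cyc[of B] that 1 unfolding V_def by simp
      qed
      then show ?thesis by (intro exI[of _ "\<lambda>_. 0"]) (simp add: bdry_def)
    next
      case 2
      have "bdry {1..r * d} f B = 0" if "B \<subseteq> {1..r * d}" "Suc (card B) = r - 1" for B
        using cyc[of B] that 2 unfolding V_def by simp
      from Omega_cycle_is_boundary[OF r a this] obtain c where c:
        "\<forall>B. B \<subseteq> V \<longrightarrow> card B = r - 1 \<longrightarrow> bdry V (\<lambda>e. if e \<in> edges H then c e else 0) B = f B"
        unfolding V_def H_def by blast
      have "simplices H (int k - 1 + 1) = edges H" unfolding above using 2 by simp
      moreover have "A \<subseteq> V \<and> card A = r - 1" if "A \<in> simplices H (int k - 1)" for A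
        using that unfolding s using 2 by auto
      ultimately show ?thesis
        using c by (intro exI[of _ "\<lambda>e. if e \<in> edges H then c e else 0"]) simp
    next
      case 3
      \<comment> \<open>The cutoff makes the support condition immediate, and every coface in
        \<open>V\<close> of a \<open>k\<close>-set passes it.\<close>
      define g where "g A = (if A \<subseteq> V \<and> card A = Suc k then cone 1 f A else 0)" for A
      have "bdry V g A = f A" if "A \<in> simplices H (int k - 1)" for A
      proof -
        have A: "A \<subseteq> V" "card A = k" using that 3 unfolding s by auto
        have "bdry V g A = bdry V (cone 1 f) A"
        proof (rule bdry_cong)
          fix v assume "v \<in> V" "v \<notin> A"
          then show "g (insert v A) = cone 1 f (insert v A)"
            unfolding g_def using A card_insert[of A v] by simp
        qed
        also have "\<dots> = f A"
        proof (rule bdry_cone[OF V A(1) \<open>1 \<in> V\<close> min])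
          assume "1 \<in> A"
          then have "Suc (card (A - {1})) = k"
            using card_Suc_Diff1[OF finite_subset[OF A(1) V]] A(2) by simp
          then show "bdry V f (A - {1}) = 0" using A(1) by (intro cyc) blast
        qed
        finally show ?thesis .
      qed
      moreover have "g A = 0" if "A \<notin> simplices H (int k - 1 + 1)" for A
        using that 3 unfolding above g_def by auto
      ultimately show ?thesis by blast
    qed
  qed
  then show ?thesis unfolding H_def .
qed

section \<open>Assembling the partition\<close>

lemma Ed_partition_nth: "i < d \<Longrightarrow> Ed_partition r d ! i = Omega r d (i + 1)"
  by (simp add: Ed_partition_def nth_upt del: upt_Suc)

lemma d_partition_Ed_partition:
  assumes r: "r \<ge> 1"
  shows "d_partition r d (Ed_partition r d)"
  unfolding d_partition_def
proof (intro conjI allI impI)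
  show "length (Ed_partition r d) = d" by (simp add: Ed_partition_def)
  show "subhypergraph (Ed_partition r d ! i) (complete_hypergraph r (r * d))" if "i < d" for i
    unfolding Ed_partition_nth[OF that] subhypergraph_def
    using edges_Omega_subset by (simp add: Omega_def complete_hypergraph_def)
  show "verts (Ed_partition r d ! i) = {1..r * d}" if "i < d" for i
    unfolding Ed_partition_nth[OF that] by (simp add: Omega_def)
  show "edges (Ed_partition r d ! i) \<inter> edges (Ed_partition r d ! j) = {}"
    if "i < d" "j < d" "i \<noteq> j" for i j
    unfolding Ed_partition_nth[OF that(1)] Ed_partition_nth[OF that(2)]
    using that(3) by (intro edges_Omega_disjoint[OF r]) simp_all
  have "(\<Union>i<d. edges (Ed_partition r d ! i)) = (\<Union>i<d. edges (Omega r d (i + 1)))"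
    using Ed_partition_nth by simp
  also have "\<dots> = (\<Union>a\<in>(\<lambda>i. i + 1) ` {..<d}. edges (Omega r d a))" by simp
  \<comment> \<open>List positions start at 0, block indices at 1.\<close>
  also have "(\<lambda>i. i + 1) ` {..<d} = {1..d}"
    by (metis One_nat_def Suc_eq_plus1_left add.commute image_Suc_lessThan image_cong)
  finally show "(\<Union>i<d. edges (Ed_partition r d ! i)) = edges (complete_hypergraph r (r * d))"
    unfolding Union_edges_Omega[OF r] .
qed

theorem theorem5p1:
  fixes r d :: nat
  assumes "r \<ge> 1" and "d \<ge> 1"
  shows "acyclic_partition r d (Ed_partition r d)"
  unfolding acyclic_partition_def homogeneous_partition_def
proof (intro conjI allI impI)
  show "d_partition r d (Ed_partition r d)"
    by (rule d_partition_Ed_partition[OF assms(1)])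
next
  fix i s assume i: "i < d" and s: "s < r"
  have a: "1 \<le> i + 1" "i + 1 \<le> d" using i by simp_all
  show "card (E_sub (Ed_partition r d ! i) s) = (r * d) choose s"
    unfolding Ed_partition_nth[OF i] E_sub_Omega[OF assms(1) a s] by (simp add: n_subsets)
next
  fix i assume i: "i < d"
  have a: "1 \<le> i + 1" "i + 1 \<le> d" using i by simp_all
  show "card (edges (Ed_partition r d ! i)) = (r * d - 1) choose (r - 1)"
    unfolding Ed_partition_nth[OF i] by (rule card_edges_Omega[OF assms(1) a])
next
  fix i k assume i: "i < d" and k: "k \<le> r"
  have a: "1 \<le> i + 1" "i + 1 \<le> d" using i by simp_all
  show "betti (Ed_partition r d ! i) (int k - 1) = 0"
    unfolding Ed_partition_nth[OF i] by (rule betti_Omega[OF assms(1) a k])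
qed

end
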